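(* Let $k$ be an algebraically closed field of characteristic zero. Let $R$ be a semisimple braided Hopf algebra over the alternating group $\mathbb A_4$ with $\dim R=5$. Then $\operatorname{Supp}(R)\subseteq\mathbb K$, where $\mathbb K\simeq\mathbb Z_2\times\mathbb Z_2$ is the Klein subgroup of $\mathbb A_4$. Therefore $R\# k\mathbb K$ is a normal Hopf subalgebra of $R\# k\mathbb A_4$ of dimension $20$.
   Context: For a finite group $G$, a (semisimple) braided Hopf algebra over $G$ is a (semisimple, as an algebra) Hopf algebra $R$ in the braided category ${}^{kG}_{kG}\mathcal{YD}$ of Yetter–Drinfeld modules over $kG$: $R$ is an algebra and a coalgebra in this category, the comultiplication $\Delta_R(a)=a^{(1)}\otimes a^{(2)}$ satisfies $\Delta_R(ab)=a^{(1)}((a^{(2)})_{-1}.b^{(1)})\otimes (a^{(2)})_0b^{(2)}$, and $\mathrm{id}_R$ has a convolution inverse (antipode). The coaction $\rho:R\to kG\otimes R$, $\rho(a)=a_{-1}\otimes a_0$, gives a grading $R=\bigoplus_{g\in G}R_g$, $R_g=\{r\in R:\rho(r)=g\otimes r\}$, which is both an algebra and a coalgebra grading; $G$ acts on $R$ by algebra and coalgebra automorphisms with $h.R_g=R_{hgh^{-1}}$. The support is $\operatorname{Supp}(R)=\{g\in G:R_g\neq 0\}$. $R\# kG$ denotes the Radford–Majid biproduct: the vector space $R\otimes kG$ with $(a\# g)(b\# h)=a(g.b)\# gh$ and $\Delta(a\# g)=a^{(1)}\#(a^{(2)})_{-1}g\otimes (a^{(2)})_0\# g$, for $a,b\in R$,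 $g,h\in G$. For a subgroup $T\subseteq G$, $R\# kT$ is the subspace $R\otimes kT$ of $R\# kG$. A Hopf subalgebra $K\subseteq H$ is normal if it is stable under the left adjoint action of $H$. *)

theory Defs
  imports
    "HOL-Algebra.Sym_Groups"
    "HOL-Algebra.Elementary_Groups"
    "HOL-Computational_Algebra.Polynomial"
    "HOL-Library.Function_Algebras"
begin

section \<open>Tensor products of vector spaces over a field\<close>

text \<open>
  A vector space is a subspace \<open>A\<close> (in the sense of \<open>module.subspace\<close>) of a type carrying a
  \<open>vector_space\<close> structure.  Functions into a vector space are scaled pointwise.
\<close>

definition fun_scale :: "('k \<Rightarrow> 'a \<Rightarrow> 'a) \<Rightarrow> 'k \<Rightarrow> ('x \<Rightarrow> 'a) \<Rightarrow> 'x \<Rightarrow> 'a"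
  where "fun_scale s c f = (\<lambda>x. s c (f x))"

definition linear_on ::
  "('k \<Rightarrow> 'a::ab_group_add \<Rightarrow> 'a) \<Rightarrow> ('k \<Rightarrow> 'b::ab_group_add \<Rightarrow> 'b) \<Rightarrow> 'a set \<Rightarrow> ('a \<Rightarrow> 'b) \<Rightarrow> bool"
  where "linear_on s1 s2 A f \<longleftrightarrow>
    (\<forall>x\<in>A. \<forall>y\<in>A. f (x + y) = f x + f y) \<and> (\<forall>c. \<forall>x\<in>A. f (s1 c x) = s2 c (f x))"

definition bilinear_on ::
  "('k \<Rightarrow> 'a::ab_group_add \<Rightarrow> 'a) \<Rightarrow> ('k \<Rightarrow> 'b::ab_group_add \<Rightarrow> 'b) \<Rightarrow> ('k \<Rightarrow> 'c::ab_group_add \<Rightarrow> 'c)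
    \<Rightarrow> 'a set \<Rightarrow> 'b set \<Rightarrow> ('a \<Rightarrow> 'b \<Rightarrow> 'c) \<Rightarrow> bool"
  where "bilinear_on s1 s2 s3 A B f \<longleftrightarrow>
    (\<forall>b\<in>B. linear_on s1 s3 A (\<lambda>a. f a b)) \<and> (\<forall>a\<in>A. linear_on s2 s3 B (f a))"

text \<open>
  The tensor product is realised inside the dual of the space of bilinear forms: \<open>a \<otimes> b\<close> is
  evaluation of a bilinear form at \<open>(a, b)\<close>, and \<open>A \<otimes> B\<close> is the span of these pure tensors.
  Over a field this is the tensor product: lemma \<open>sweedler_sum_list\<close> below is its universal
  property, and it also makes \<open>A \<otimes> B\<close> independent of the types in which \<open>A\<close> and \<open>B\<close> live.
\<close>

type_synonym ('k, 'a, 'b) tens = "('a \<Rightarrow> 'b \<Rightarrow> 'k) \<Rightarrow> 'k"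

definition tensor ::
  "('k::field \<Rightarrow> 'a::ab_group_add \<Rightarrow> 'a) \<Rightarrow> ('k \<Rightarrow> 'b::ab_group_add \<Rightarrow> 'b) \<Rightarrow> 'a \<Rightarrow> 'b \<Rightarrow> ('k, 'a, 'b) tens"
  where "tensor s1 s2 a b = (\<lambda>\<beta>. if bilinear_on s1 s2 (*) UNIV UNIV \<beta> then \<beta> a b else 0)"

abbreviation tens_scale :: "'k::field \<Rightarrow> ('k, 'a, 'b) tens \<Rightarrow> ('k, 'a, 'b) tens"
  where "tens_scale \<equiv> fun_scale (*)"

definition tensor_space ::
  "('k::field \<Rightarrow> 'a::ab_group_add \<Rightarrow> 'a) \<Rightarrow> ('k \<Rightarrow> 'b::ab_group_add \<Rightarrow> 'b) \<Rightarrow> 'a set \<Rightarrow> 'b set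
    \<Rightarrow> ('k, 'a, 'b) tens set"
  where "tensor_space s1 s2 A B = module.span tens_scale {tensor s1 s2 a b | a b. a \<in> A \<and> b \<in> B}"

text \<open>
  For \<open>t \<in> A \<otimes> B\<close>, written \<open>t = t\<^sub>1 \<otimes> t\<^sub>2\<close> in Sweedler notation, and \<open>f\<close> bilinear on \<open>A \<times> B\<close>,
  \<open>sweedler s1 s2 A B f t\<close> is \<open>f(t\<^sub>1, t\<^sub>2)\<close>.  The choice of a representing sum of pure tensors is
  immaterial by \<open>sweedler_sum_list\<close>.
\<close>

definition sweedler ::
  "('k::field \<Rightarrow> 'a::ab_group_add \<Rightarrow> 'a) \<Rightarrow> ('k \<Rightarrow> 'b::ab_group_add \<Rightarrow> 'b) \<Rightarrow> 'a set \<Rightarrow> 'b set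
    \<Rightarrow> ('a \<Rightarrow> 'b \<Rightarrow> 'c::ab_group_add) \<Rightarrow> ('k, 'a, 'b) tens \<Rightarrow> 'c"
  where "sweedler s1 s2 A B f t =
    (let xs = (SOME xs. set xs \<subseteq> A \<times> B \<and> t = (\<Sum>(a, b)\<leftarrow>xs. tensor s1 s2 a b))
     in \<Sum>(a, b)\<leftarrow>xs. f a b)"

lemma vector_space_fun_scale:
  assumes "vector_space s" shows "vector_space (fun_scale s)"
proof -
  interpret vector_space s by fact
  show ?thesis
    by unfold_locales (auto simp: fun_scale_def fun_eq_iff scale_right_distrib scale_left_distrib)
qed

lemma vector_space_field: "vector_space ((*) :: 'k::field \<Rightarrow> 'k \<Rightarrow> 'k)"
  by unfold_locales (auto simp: algebra_simps)

lemma sum_list_tensor_apply: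
  "(\<Sum>(a, b)\<leftarrow>xs. tensor s1 s2 a b) \<beta> = (\<Sum>(a, b)\<leftarrow>xs. tensor s1 s2 a b \<beta>)"
  by (induction xs) auto

lemma tensor_space_rep:
  assumes s1: "vector_space s1" and A: "module.subspace s1 A"
    and t: "t \<in> tensor_space s1 s2 A B"
  obtains xs where "set xs \<subseteq> A \<times> B" "t = (\<Sum>(a, b)\<leftarrow>xs. tensor s1 s2 a b)"
proof -
  interpret s1: vector_space s1 by fact
  interpret T: vector_space "tens_scale :: _ \<Rightarrow> ('a, 'b, 'c) tens \<Rightarrow> _"
    by (intro vector_space_fun_scale vector_space_field)
  have "\<exists>xs. set xs \<subseteq> A \<times> B \<and> t = (\<Sum>(a, b)\<leftarrow>xs. tensor s1 s2 a b)"
    using t unfolding tensor_space_def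
  proof (induction rule: T.span_induct_alt)
    case base
    then show ?case by (intro exI[of _ "[]"]) simp
  next
    case (step c x y)
    then obtain a b xs where x: "a \<in> A" "b \<in> B" "x = tensor s1 s2 a b"
      and xs: "set xs \<subseteq> A \<times> B" "y = (\<Sum>(a, b)\<leftarrow>xs. tensor s1 s2 a b)" by blast
    have "tens_scale c x = tensor s1 s2 (s1 c a) b"
      by (auto simp: x fun_scale_def tensor_def bilinear_on_def linear_on_def fun_eq_iff)
    with x xs A show ?case
      by (intro exI[of _ "(s1 c a, b) # xs"]) (auto simp: s1.subspace_def)
  qed
  with that show ?thesis by blast
qed

lemma sweedler_sum_list:
  assumes s1: "vector_space s1" and s2: "vector_space s2" and s3: "vector_space s3"
    and A: "module.subspace s1 A" and B: "module.subspace s2 B"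
    and f: "bilinear_on s1 s2 s3 A B f" and xs: "set xs \<subseteq> A \<times> B"
  shows "sweedler s1 s2 A B f (\<Sum>(a, b)\<leftarrow>xs. tensor s1 s2 a b) = (\<Sum>(a, b)\<leftarrow>xs. f a b)"
proof -
  interpret s1: vector_space s1 by fact
  interpret s2: vector_space s2 by fact
  interpret s3: vector_space s3 by fact
  interpret F: vector_space "(*) :: 'a \<Rightarrow> 'a \<Rightarrow> 'a" by (rule vector_space_field)
  interpret p1: vector_space_pair s1 s1 by unfold_locales
  interpret p2: vector_space_pair s2 s2 by unfold_locales
  interpret p3: vector_space_pair s3 "(*) :: 'a \<Rightarrow> 'a \<Rightarrow> 'a" by unfold_locales
  obtain p where p: "range p \<subseteq> A" "Vector_Spaces.linear s1 s1 p" "\<And>v. v \<in> A \<Longrightarrow> p v = v"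
    using p1.linear_exists_left_inverse_on[OF s1.linear_id A] by (auto simp: inj_on_def)
  obtain q where q: "range q \<subseteq> B" "Vector_Spaces.linear s2 s2 q" "\<And>v. v \<in> B \<Longrightarrow> q v = v"
    using p2.linear_exists_left_inverse_on[OF s2.linear_id B] by (auto simp: inj_on_def)
  interpret p: Vector_Spaces.linear s1 s1 p by (rule p)
  interpret q: Vector_Spaces.linear s2 s2 q by (rule q)
  have key: "(\<Sum>(a, b)\<leftarrow>ys. f a b) = (\<Sum>(a, b)\<leftarrow>xs. f a b)"
    if ys: "set ys \<subseteq> A \<times> B"
      and eq: "(\<Sum>(a, b)\<leftarrow>xs. tensor s1 s2 a b) = (\<Sum>(a, b)\<leftarrow>ys. tensor s1 s2 a b)" for ys
  proof (rule ccontr)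
    define u where "u = (\<Sum>(a, b)\<leftarrow>ys. f a b) - (\<Sum>(a, b)\<leftarrow>xs. f a b)"
    assume "\<not> ?thesis"
    then have "u \<noteq> 0" by (simp add: u_def)
    then have "s3.independent {u}" by simp
    from p3.linear_independent_extend[OF this, of "\<lambda>_. 1"]
    obtain \<phi> where \<phi>: "Vector_Spaces.linear s3 (*) \<phi>" "\<phi> u = 1" by auto
    interpret \<phi>: Vector_Spaces.linear s3 "(*)" \<phi> by (rule \<phi>)
    define \<beta> where "\<beta> = (\<lambda>x y. \<phi> (f (p x) (q y)))"
    have pA: "p x \<in> A" and qB: "q y \<in> B" for x y using p(1) q(1) by auto
    have \<beta>: "bilinear_on s1 s2 (*) UNIV UNIV \<beta>"
      using f pA qB
      by (simp add: bilinear_on_def linear_on_def \<beta>_def p.add p.scale q.add q.scale \<phi>.add \<phi>.scale)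
    have ev: "(\<Sum>(a, b)\<leftarrow>zs. tensor s1 s2 a b) \<beta> = \<phi> (\<Sum>(a, b)\<leftarrow>zs. f a b)"
      if "set zs \<subseteq> A \<times> B" for zs
      using that
      by (induction zs) (auto simp: tensor_def \<beta> \<phi>.add \<phi>.zero, simp add: \<beta>_def p q)
    from ev[OF xs] ev[OF ys] eq have "\<phi> u = 0" by (simp add: u_def \<phi>.diff)
    with \<phi> show False by simp
  qed
  let ?P = "\<lambda>ys. set ys \<subseteq> A \<times> B \<and>
    (\<Sum>(a, b)\<leftarrow>xs. tensor s1 s2 a b) = (\<Sum>(a, b)\<leftarrow>ys. tensor s1 s2 a b)"
  have "?P (Eps ?P)" by (rule someI[of ?P xs]) (use xs in simp)
  then show ?thesis unfolding sweedler_def Let_def by (intro key) blast+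
qed


section \<open>Algebras, coalgebras, Hopf algebras\<close>

record ('k, 'a) hopf_data =
  car :: "'a set"
  scl :: "'k \<Rightarrow> 'a \<Rightarrow> 'a"
  mul :: "'a \<Rightarrow> 'a \<Rightarrow> 'a"
  uni :: "'a"
  cmul :: "'a \<Rightarrow> ('k, 'a, 'a) tens"
  cuni :: "'a \<Rightarrow> 'k"

abbreviation tens where "tens A \<equiv> tensor (scl A) (scl A)"

abbreviation sw where "sw A \<equiv> sweedler (scl A) (scl A) (car A) (car A)"

locale k_space =
  fixes A :: "('k::field, 'a::ab_group_add, 'm) hopf_data_scheme"
  assumes scale: "vector_space (scl A)"
    and subspace: "module.subspace (scl A) (car A)"

locale k_algebra = k_space +
  assumes mul_closed: "\<lbrakk>x \<in> car A; y \<in> car A\<rbrakk> \<Longrightarrow> mul A x y \<in> car A"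
    and mul_bilinear: "bilinear_on (scl A) (scl A) (scl A) (car A) (car A) (mul A)"
    and mul_assoc: "\<lbrakk>x \<in> car A; y \<in> car A; z \<in> car A\<rbrakk> \<Longrightarrow>
      mul A (mul A x y) z = mul A x (mul A y z)"
    and uni_closed: "uni A \<in> car A"
    and uni_left: "x \<in> car A \<Longrightarrow> mul A (uni A) x = x"
    and uni_right: "x \<in> car A \<Longrightarrow> mul A x (uni A) = x"

text \<open>In \<open>coassoc\<close> both sides are elements of \<open>(A \<otimes> A) \<otimes> A\<close>.\<close>

locale k_coalgebra = k_space +
  assumes cmul_closed: "x \<in> car A \<Longrightarrow> cmul A x \<in> tensor_space (scl A) (scl A) (car A) (car A)"
    and cmul_linear: "linear_on (scl A) tens_scale (car A) (cmul A)"
    and cuni_linear: "linear_on (scl A) (*) (car A) (cuni A)"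
    and coassoc: "x \<in> car A \<Longrightarrow>
      sw A (\<lambda>x1 x2. sw A (\<lambda>u v. tensor tens_scale (scl A) (tens A u v) x2) (cmul A x1)) (cmul A x) =
      sw A (\<lambda>x1 x2. sw A (\<lambda>u v. tensor tens_scale (scl A) (tens A x1 u) v) (cmul A x2)) (cmul A x)"
    and counit_left: "x \<in> car A \<Longrightarrow> sw A (\<lambda>x1 x2. scl A (cuni A x1) x2) (cmul A x) = x"
    and counit_right: "x \<in> car A \<Longrightarrow> sw A (\<lambda>x1 x2. scl A (cuni A x2) x1) (cmul A x) = x"

definition is_antipode ::
  "('k::field, 'a::ab_group_add, 'm) hopf_data_scheme \<Rightarrow> ('a \<Rightarrow> 'a) \<Rightarrow> bool"
  where "is_antipode A S \<longleftrightarrow>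
    S ` car A \<subseteq> car A \<and> linear_on (scl A) (scl A) (car A) S \<and>
    (\<forall>x\<in>car A. sw A (\<lambda>x1 x2. mul A (S x1) x2) (cmul A x) = scl A (cuni A x) (uni A) \<and>
               sw A (\<lambda>x1 x2. mul A x1 (S x2)) (cmul A x) = scl A (cuni A x) (uni A))"

locale hopf_algebra = k_algebra A + k_coalgebra A
  for A :: "('k::field, 'a::ab_group_add, 'm) hopf_data_scheme" +
  assumes cmul_mul: "\<lbrakk>x \<in> car A; y \<in> car A\<rbrakk> \<Longrightarrow> cmul A (mul A x y) =
      sw A (\<lambda>x1 x2. sw A (\<lambda>y1 y2. tens A (mul A x1 y1) (mul A x2 y2)) (cmul A y)) (cmul A x)"
    and cmul_uni: "cmul A (uni A) = tens A (uni A) (uni A)"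
    and cuni_mul: "\<lbrakk>x \<in> car A; y \<in> car A\<rbrakk> \<Longrightarrow> cuni A (mul A x y) = cuni A x * cuni A y"
    and cuni_uni: "cuni A (uni A) = 1"
    and antipode: "\<exists>S. is_antipode A S"

text \<open>The antipode is unique on the carrier; its values elsewhere are never used.\<close>

definition antipode :: "('k::field, 'a::ab_group_add, 'm) hopf_data_scheme \<Rightarrow> 'a \<Rightarrow> 'a"
  where "antipode A = (SOME S. is_antipode A S)"

definition hopf_subalgebra ::
  "'a set \<Rightarrow> ('k::field, 'a::ab_group_add, 'm) hopf_data_scheme \<Rightarrow> bool"
  where "hopf_subalgebra K H \<longleftrightarrow>
    hopf_algebra H \<and> module.subspace (scl H) K \<and> K \<subseteq> car H \<and>
    uni H \<in> K \<and> (\<forall>x\<in>K. \<forall>y\<in>K. mul H x y \<in> K) \<and>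
    (\<forall>x\<in>K. cmul H x \<in> tensor_space (scl H) (scl H) K K) \<and>
    (\<forall>x\<in>K. antipode H x \<in> K)"

definition left_adjoint ::
  "('k::field, 'a::ab_group_add, 'm) hopf_data_scheme \<Rightarrow> 'a \<Rightarrow> 'a \<Rightarrow> 'a"
  where "left_adjoint H h x = sw H (\<lambda>h1 h2. mul H (mul H h1 x) (antipode H h2)) (cmul H h)"

definition normal_hopf_subalgebra ::
  "'a set \<Rightarrow> ('k::field, 'a::ab_group_add, 'm) hopf_data_scheme \<Rightarrow> bool"
  where "normal_hopf_subalgebra K H \<longleftrightarrow>
    hopf_subalgebra K H \<and> (\<forall>h\<in>car H. \<forall>x\<in>K. left_adjoint H h x \<in> K)"

definition left_ideal ::
  "'a set \<Rightarrow> ('k::field, 'a::ab_group_add, 'm) hopf_data_scheme \<Rightarrow> bool"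
  where "left_ideal L A \<longleftrightarrow>
    module.subspace (scl A) L \<and> L \<subseteq> car A \<and> (\<forall>a\<in>car A. \<forall>x\<in>L. mul A a x \<in> L)"

definition simple_left_ideal ::
  "'a set \<Rightarrow> ('k::field, 'a::ab_group_add, 'm) hopf_data_scheme \<Rightarrow> bool"
  where "simple_left_ideal L A \<longleftrightarrow>
    left_ideal L A \<and> L \<noteq> {0} \<and> (\<forall>I. left_ideal I A \<and> I \<subseteq> L \<longrightarrow> I = {0} \<or> I = L)"

text \<open>The left regular module is a sum of simple submodules.\<close>

definition semisimple_algebra ::
  "('k::field, 'a::ab_group_add, 'm) hopf_data_scheme \<Rightarrow> bool"
  where "semisimple_algebra A \<longleftrightarrow>
    k_algebra A \<and> module.span (scl A) (\<Union>{L. simple_left_ideal L A}) = car A"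


section \<open>Braided Hopf algebras over a finite group\<close>

text \<open>
  For a finite group \<open>G\<close>, both \<open>kG \<otimes> R\<close> and \<open>R \<otimes> kG\<close> are identified with the space of functions
  from \<open>G\<close> to \<open>R\<close> (extended by \<open>0\<close> outside \<open>G\<close>), via the basis \<open>G\<close> of \<open>kG\<close>; then
  \<open>single g a\<close> is \<open>g \<otimes> a\<close>, respectively \<open>a \<otimes> g\<close> (written \<open>a # g\<close> in the biproduct).
  Thus the coaction is \<open>\<rho>(a) = (\<Sum>g\<in>G. g \<otimes> coact R a g)\<close>, and in a Sweedler expression linear in
  \<open>a\<^sub>-\<^sub>1 \<otimes> a\<^sub>0\<close> this pair becomes \<open>g\<close>, \<open>coact R a g\<close> with a sum over \<open>g \<in> G\<close>.
\<close>

definition single :: "'g \<Rightarrow> 'a \<Rightarrow> 'g \<Rightarrow> 'a::zero"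
  where "single g a = (\<lambda>x. if x = g then a else 0)"

definition fun_space :: "'g set \<Rightarrow> 'a::zero set \<Rightarrow> ('g \<Rightarrow> 'a) set"
  where "fun_space T V = {f. (\<forall>g\<in>T. f g \<in> V) \<and> (\<forall>g. g \<notin> T \<longrightarrow> f g = 0)}"

record ('k, 'a, 'g) braided_data = "('k, 'a) hopf_data" +
  act :: "'g \<Rightarrow> 'a \<Rightarrow> 'a"
  coact :: "'a \<Rightarrow> 'g \<Rightarrow> 'a"

text \<open>
  Axiom \<open>coact_coassoc\<close> is \<open>(id \<otimes> \<rho>)\<rho>(a) = (\<Delta> \<otimes> id)\<rho>(a)\<close> with \<open>\<Delta>(g) = g \<otimes> g\<close>, compared at the
  coefficient of \<open>g\<close> in the left tensor factor; \<open>coact_act\<close> is the compatibility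
  \<open>\<rho>(h.a) = h a\<^sub>-\<^sub>1 h\<^sup>-\<^sup>1 \<otimes> h.a\<^sub>0\<close>.
\<close>

locale yetter_drinfeld = group G + k_space R
  for G :: "('g, 'z) monoid_scheme" (structure)
    and R :: "('k::field, 'a::ab_group_add, 'g, 'm) braided_data_scheme" +
  assumes finite_group: "finite (carrier G)"
    and act_closed: "\<lbrakk>g \<in> carrier G; a \<in> car R\<rbrakk> \<Longrightarrow> act R g a \<in> car R"
    and act_linear: "g \<in> carrier G \<Longrightarrow> linear_on (scl R) (scl R) (car R) (act R g)"
    and act_one: "a \<in> car R \<Longrightarrow> act R \<one> a = a"
    and act_mult: "\<lbrakk>g \<in> carrier G; h \<in> carrier G; a \<in> car R\<rbrakk> \<Longrightarrow>
      act R (g \<otimes> h) a = act R g (act R h a)"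
    and coact_closed: "a \<in> car R \<Longrightarrow> coact R a \<in> fun_space (carrier G) (car R)"
    and coact_linear: "linear_on (scl R) (fun_scale (scl R)) (car R) (coact R)"
    and coact_counit: "a \<in> car R \<Longrightarrow> (\<Sum>g\<in>carrier G. coact R a g) = a"
    and coact_coassoc: "\<lbrakk>a \<in> car R; g \<in> carrier G\<rbrakk> \<Longrightarrow>
      coact R (coact R a g) = single g (coact R a g)"
    and coact_act: "\<lbrakk>h \<in> carrier G; a \<in> car R\<rbrakk> \<Longrightarrow>
      coact R (act R h a) = (\<Sum>g\<in>carrier G. single (h \<otimes> g \<otimes> inv h) (act R h (coact R a g)))"

text \<open>
  The axioms say in turn that \<open>R\<close> is an algebra and a coalgebra, that all four structure maps are
  \<open>G\<close>-linear and \<open>G\<close>-colinear (for the diagonal action and coaction on \<open>R \<otimes> R\<close> and the trivial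
  ones on \<open>k\<close>), that \<open>\<Delta>\<close> and \<open>\<epsilon>\<close> are algebra maps (with the braided product on \<open>R \<otimes> R\<close>), and that
  \<open>id\<close> is convolution invertible.
\<close>

locale braided_hopf_algebra = yetter_drinfeld G R + k_algebra R + k_coalgebra R
  for G :: "('g, 'z) monoid_scheme" (structure)
    and R :: "('k::field, 'a::ab_group_add, 'g, 'm) braided_data_scheme" +
  assumes act_mul: "\<lbrakk>g \<in> carrier G; a \<in> car R; b \<in> car R\<rbrakk> \<Longrightarrow>
      act R g (mul R a b) = mul R (act R g a) (act R g b)"
    and act_uni: "g \<in> carrier G \<Longrightarrow> act R g (uni R) = uni R"
    and coact_mul: "\<lbrakk>a \<in> car R; b \<in> car R\<rbrakk> \<Longrightarrow> coact R (mul R a b) =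
      (\<Sum>g\<in>carrier G. \<Sum>h\<in>carrier G. single (g \<otimes> h) (mul R (coact R a g) (coact R b h)))"
    and coact_uni: "coact R (uni R) = single \<one> (uni R)"
    and cmul_act: "\<lbrakk>g \<in> carrier G; a \<in> car R\<rbrakk> \<Longrightarrow>
      cmul R (act R g a) = sw R (\<lambda>a1 a2. tens R (act R g a1) (act R g a2)) (cmul R a)"
    and cuni_act: "\<lbrakk>g \<in> carrier G; a \<in> car R\<rbrakk> \<Longrightarrow> cuni R (act R g a) = cuni R a"
    and cmul_coact: "a \<in> car R \<Longrightarrow>
      (\<Sum>g\<in>carrier G. single g (cmul R (coact R a g))) =
      sw R (\<lambda>a1 a2. \<Sum>g\<in>carrier G. \<Sum>h\<in>carrier G.
              single (g \<otimes> h) (tens R (coact R a1 g) (coact R a2 h))) (cmul R a)"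
    and cuni_coact: "a \<in> car R \<Longrightarrow>
      (\<Sum>g\<in>carrier G. single g (cuni R (coact R a g))) = single \<one> (cuni R a)"
    and braided_cmul_mul: "\<lbrakk>a \<in> car R; b \<in> car R\<rbrakk> \<Longrightarrow> cmul R (mul R a b) =
      sw R (\<lambda>a1 a2. sw R (\<lambda>b1 b2. \<Sum>g\<in>carrier G.
              tens R (mul R a1 (act R g b1)) (mul R (coact R a2 g) b2)) (cmul R b)) (cmul R a)"
    and cmul_uni: "cmul R (uni R) = tens R (uni R) (uni R)"
    and cuni_mul: "\<lbrakk>a \<in> car R; b \<in> car R\<rbrakk> \<Longrightarrow> cuni R (mul R a b) = cuni R a * cuni R b"
    and cuni_uni: "cuni R (uni R) = 1"
    and antipode: "\<exists>S. is_antipode R S"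

definition homogeneous ::
  "('k::field, 'a::ab_group_add, 'g, 'm) braided_data_scheme \<Rightarrow> 'g \<Rightarrow> 'a set"
  where "homogeneous R g = {r \<in> car R. coact R r = single g r}"

definition supp ::
  "('g, 'z) monoid_scheme \<Rightarrow> ('k::field, 'a::ab_group_add, 'g, 'm) braided_data_scheme \<Rightarrow> 'g set"
  where "supp G R = {g \<in> carrier G. homogeneous R g \<noteq> {0}}"

text \<open>
  The Radford--Majid biproduct \<open>R # kG\<close>; product and coproduct are the (bi)linear extensions of
  \<open>(a # g)(b # h) = a(g.b) # gh\<close> and
  \<open>\<Delta>(a # g) = a\<^sub>1 # (a\<^sub>2)\<^sub>-\<^sub>1 g \<otimes> (a\<^sub>2)\<^sub>0 # g\<close>.
\<close>

definition biproduct ::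
  "('g, 'z) monoid_scheme \<Rightarrow> ('k::field, 'a::ab_group_add, 'g, 'm) braided_data_scheme
    \<Rightarrow> ('k, 'g \<Rightarrow> 'a) hopf_data"
  where "biproduct G R = \<lparr>
    car = fun_space (carrier G) (car R),
    scl = fun_scale (scl R),
    mul = (\<lambda>p q. \<Sum>g\<in>carrier G. \<Sum>h\<in>carrier G. single (g \<otimes>\<^bsub>G\<^esub> h) (mul R (p g) (act R g (q h)))),
    uni = single \<one>\<^bsub>G\<^esub> (uni R),
    cmul = (\<lambda>p. \<Sum>g\<in>carrier G.
      sw R (\<lambda>a1 a2. \<Sum>x\<in>carrier G.
              tensor (fun_scale (scl R)) (fun_scale (scl R))
                (single (x \<otimes>\<^bsub>G\<^esub> g) a1) (single g (coact R a2 x))) (cmul R (p g))),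
    cuni = (\<lambda>p. \<Sum>g\<in>carrier G. cuni R (p g)) \<rparr>"

definition biproduct_sub ::
  "'g set \<Rightarrow> ('k::field, 'a::ab_group_add, 'g, 'm) braided_data_scheme \<Rightarrow> ('g \<Rightarrow> 'a) set"
  where "biproduct_sub T R = fun_space T (car R)"


section \<open>The Klein subgroup of the alternating group on four letters\<close>

definition klein :: "(nat \<Rightarrow> nat) set"
  where "klein = {id, transpose 1 2 \<circ> transpose 3 4, transpose 1 3 \<circ> transpose 2 4,
                  transpose 1 4 \<circ> transpose 2 3}"

lemma klein_mult:
  fixes a b c :: "nat \<Rightarrow> nat"
  defines "a \<equiv> transpose 1 2 \<circ> transpose 3 4" and "b \<equiv> transpose 1 3 \<circ> transpose 2 4"
    and "c \<equiv> transpose 1 4 \<circ> transpose 2 3"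
  shows "a \<circ> a = id" "b \<circ> b = id" "c \<circ> c = id" "a \<circ> b = c" "b \<circ> a = c"
    "a \<circ> c = b" "c \<circ> a = b" "b \<circ> c = a" "c \<circ> b = a"
    "a \<noteq> id" "b \<noteq> id" "c \<noteq> id" "a \<noteq> b" "a \<noteq> c" "b \<noteq> c"
proof -
  have v: "a 1 = 2" "b 1 = 3" "c 1 = 4" by (simp_all add: a_def b_def c_def transpose_def)
  show "a \<noteq> id" "b \<noteq> id" "c \<noteq> id" "a \<noteq> b" "a \<noteq> c" "b \<noteq> c"
    using v by (metis id_apply numeral_eq_iff num.distinct semiring_norm one_eq_numeral_iff)+
qed (auto simp: a_def b_def c_def fun_eq_iff transpose_def)

lemma subgroup_klein: "subgroup klein (alt_group 4)"
proof -
  interpret group "alt_group 4" by (rule alt_group_is_group)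
  have perm: "p \<in> carrier (alt_group 4)" if "p \<in> klein" for p
    using that unfolding klein_def alt_group_carrier
    by (auto intro!: permutes_compose permutes_swap_id simp: permutes_id evenperm_comp
        permutation_swap_id evenperm_swap)
  have sq: "p \<circ> p = id" if "p \<in> klein" for p
    using that by (auto simp: klein_def klein_mult[unfolded One_nat_def])
  have cl: "p \<circ> q \<in> klein" if "p \<in> klein" "q \<in> klein" for p q
    using that unfolding klein_def
    by (elim insertE emptyE; simp only: klein_mult id_comp comp_id; simp)
  show ?thesis
  proof (rule subgroupI)
    show "inv\<^bsub>alt_group 4\<^esub> p \<in> klein" if "p \<in> klein" for p
      using that sq[OF that] perm[OF that]
      by (metis alt_group_mult alt_group_one inv_equality)
  qed (use perm cl in \<open>auto simp: alt_group_mult klein_def\<close>)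
qed

lemma klein_iso:
  "(alt_group 4)\<lparr>carrier := klein\<rparr> \<cong> integer_mod_group 2 \<times>\<times> integer_mod_group 2"
proof -
  define a b c :: "nat \<Rightarrow> nat" where "a = transpose 1 2 \<circ> transpose 3 4"
    and "b = transpose 1 3 \<circ> transpose 2 4" and "c = transpose 1 4 \<circ> transpose 2 3"
  note k = klein_mult[folded a_def b_def c_def]
  have K: "klein = {id, a, b, c}" by (simp add: klein_def a_def b_def c_def)
  have Z: "carrier (integer_mod_group 2) = {0, 1}"
    by (auto simp: carrier_integer_mod_group)
  define h :: "(nat \<Rightarrow> nat) \<Rightarrow> int \<times> int" where
    "h = (\<lambda>p. if p = id then (0, 0) else if p = a then (1, 0) else if p = b then (0, 1) else (1, 1))"
  have hv: "h id = (0, 0)" "h a = (1, 0)" "h b = (0, 1)" "h c = (1, 1)"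
    using k by (auto simp: h_def)
  have "h \<in> hom ((alt_group 4)\<lparr>carrier := klein\<rparr>) (integer_mod_group 2 \<times>\<times> integer_mod_group 2)"
    unfolding hom_def
    by (auto simp: K Z hv k alt_group_mult DirProd_def mult_integer_mod_group)
  moreover have "bij_betw h klein ({0, 1} \<times> {0, 1})"
    using k by (auto simp: bij_betw_def inj_on_def K hv)
  ultimately show ?thesis
    unfolding is_iso_def iso_def by (auto simp: Z DirProd_def)
qed

end

theory Submission
  imports Defs
begin

text \<open>
  Let \<open>K\<close> be the Klein subgroup.  If the support contained some \<open>g \<notin> K\<close>, it would
  contain the four conjugates \<open>c\<close> of \<open>g\<close> under \<open>K\<close>; as \<open>dim R = 5\<close>, then \<open>R\<close> is the
  sum of \<open>k1\<close> and the four lines \<open>R\<^sub>c\<close>.  All \<open>c\<close> lie in the coset \<open>gK\<close> and their products in \<open>g\<^sup>2K\<close>, which misses the support, so the four lines span a nilpotent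
  ideal, contradicting semisimplicity.

  For any normal subgroup \<open>T\<close> containing the support, the second tensor factors occurring in
  products, coproducts and antipodes of elements of \<open>R # kT\<close> stay in \<open>T\<close>.  Normality follows since
  \<open>R # kG\<close> is graded by \<open>G\<close> through its second factor: the adjoint action of \<open>a # g\<close> sends degree
  \<open>t\<close> into degrees \<open>y t y\<^sup>-\<^sup>1\<close> with \<open>y = (a\<^sub>2)\<^sub>-\<^sub>1 g\<close>.
\<close>

section \<open>Linear maps and Sweedler sums\<close>

text \<open>The number 5 is exactly 1 + |K|. A 3-cycle commutes with no nontrivial double
  transposition, so K acts freely by conjugation outside itself, and an orbit of four degrees
  together with the degree of the unit exhausts the dimension. The contradiction is drawn from one
  line of the ideal: a nonzero \<open>n\<close> of degree \<open>g\<close> satisfies n n = 0 and R n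
  \<subseteq> k n, which already makes \<open>n\<close> annihilate every simple left ideal.

  Most of the development serves the second claim, because \<open>hopf_subalgebra\<close> contains
  the assertion that the ambient algebra is a Hopf algebra; all Hopf axioms of R # kG must be
  derived. Two choice operators stand in the way: \<open>sweedler\<close> picks some list of pure
  tensors, and \<open>antipode\<close> picks some antipode. The first is controlled by evaluating
  coproducts against bilinear maps (\<open>cosum\<close>) instead of handling tensors, the second by
  uniqueness of antipodes, which lets the explicit \<open>biprod_antipode\<close> replace the chosen
  one.\<close>

lemma linear_onD:
  assumes "linear_on s1 s2 A f"
  shows "\<lbrakk>x \<in> A; y \<in> A\<rbrakk> \<Longrightarrow> f (x + y) = f x + f y" "x \<in> A \<Longrightarrow> f (s1 c x) = s2 c (f x)"
  using assms by (auto simp: linear_on_def)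

lemma linear_on_zero:
  assumes "vector_space s1" "module.subspace s1 A" "linear_on s1 s2 A f"
  shows "f 0 = 0"
proof -
  interpret vector_space s1 by fact
  have "f (0 + 0) = f 0 + f 0"
    using assms(2,3) by (intro linear_onD(1)) (auto simp: subspace_0)
  then show ?thesis by simp
qed

lemma linear_on_sum_image:
  assumes "vector_space s1" "module.subspace s1 A" "linear_on s1 s2 A f" "\<And>i. i \<in> I \<Longrightarrow> g i \<in> A"
  shows "f (\<Sum>i\<in>I. g i) = (\<Sum>i\<in>I. f (g i))"
proof -
  interpret vector_space s1 by fact
  show ?thesis
    using assms(4)
  proof (induction I rule: infinite_finite_induct)
    case (insert x F)
    have "(\<Sum>i\<in>F. g i) \<in> A" using insert.prems by (intro subspace_sum assms(2)) auto
    with insert show ?case by (simp add: linear_onD(1)[OF assms(3)])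
  qed (use linear_on_zero[OF assms(1-3)] in auto)
qed

lemma subspace_sum_list:
  assumes "vector_space s" "module.subspace s A" "set (map g xs) \<subseteq> A"
  shows "(\<Sum>x\<leftarrow>xs. g x) \<in> A"
proof -
  interpret vector_space s by fact
  show ?thesis
    using assms(3) by (induction xs) (auto simp: subspace_0 subspace_add assms(2))
qed

lemma linear_on_sum_list_image:
  assumes "vector_space s1" "module.subspace s1 A" "linear_on s1 s2 A f" "set (map g xs) \<subseteq> A"
  shows "f (\<Sum>x\<leftarrow>xs. g x) = (\<Sum>x\<leftarrow>xs. f (g x))"
proof -
  show ?thesis
    using assms(4)
  proof (induction xs)
    case (Cons x xs)
    then have "(\<Sum>x\<leftarrow>xs. g x) \<in> A" by (intro subspace_sum_list[OF assms(1,2)]) auto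
    with Cons show ?case by (simp add: linear_onD(1)[OF assms(3)])
  qed (use linear_on_zero[OF assms(1-3)] in auto)
qed

lemma linear_on_id: "linear_on s s A (\<lambda>x. x)"
  by (simp add: linear_on_def)

lemma linear_on_compose:
  assumes "linear_on s2 s3 B g" "linear_on s1 s2 A f" "\<And>x. x \<in> A \<Longrightarrow> f x \<in> B"
  shows "linear_on s1 s3 A (\<lambda>x. g (f x))"
  using assms by (auto simp: linear_on_def)

lemma linear_on_sum:
  assumes "vector_space s2" "\<And>i. i \<in> I \<Longrightarrow> linear_on s1 s2 A (f i)"
  shows "linear_on s1 s2 A (\<lambda>x. \<Sum>i\<in>I. f i x)"
proof -
  interpret vector_space s2 by fact
  show ?thesis
    using assms(2) by (simp add: linear_on_def sum.distrib scale_sum_right)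
qed

lemma linear_on_sum_list:
  assumes "vector_space s2" "\<And>i. i \<in> set xs \<Longrightarrow> linear_on s1 s2 A (f i)"
  shows "linear_on s1 s2 A (\<lambda>x. \<Sum>i\<leftarrow>xs. f i x)"
proof -
  interpret vector_space s2 by fact
  show ?thesis
    using assms(2)
    by (induction xs) (auto simp add: linear_on_def scale_right_distrib algebra_simps)
qed

lemma linear_on_scale_left:
  assumes "vector_space s" "linear_on s1 (*) A f"
  shows "linear_on s1 s A (\<lambda>x. s (f x) v)"
proof -
  interpret vector_space s by fact
  show ?thesis using assms(2) by (auto simp: linear_on_def scale_left_distrib)
qed

lemma linear_on_scale_right:
  assumes "vector_space s" "linear_on s1 s A f"
  shows "linear_on s1 s A (\<lambda>x. s c (f x))"
proof -
  interpret vector_space s by fact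
  show ?thesis using assms(2) by (auto simp: linear_on_def scale_right_distrib mult.commute)
qed

lemma linear_on_fun_apply:
  assumes "linear_on s1 (fun_scale s2) A f"
  shows "linear_on s1 s2 A (\<lambda>x. f x y)"
  using assms by (auto simp: linear_on_def fun_scale_def)

lemma bilinear_onI:
  assumes "\<And>b. b \<in> B \<Longrightarrow> linear_on s1 s3 A (\<lambda>a. f a b)" "\<And>a. a \<in> A \<Longrightarrow> linear_on s2 s3 B (\<lambda>b. f a b)"
  shows "bilinear_on s1 s2 s3 A B f"
  using assms by (auto simp: bilinear_on_def)

lemma bilinear_onD:
  assumes "bilinear_on s1 s2 s3 A B f"
  shows "b \<in> B \<Longrightarrow> linear_on s1 s3 A (\<lambda>a. f a b)" "a \<in> A \<Longrightarrow> linear_on s2 s3 B (\<lambda>b. f a b)"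
  using assms by (auto simp: bilinear_on_def)

text \<open>The default value 0 of \<open>tensor\<close> at non-bilinear forms is what makes this
  hold for arbitrary sets and scalings.\<close>

lemma bilinear_on_tensor: "bilinear_on s1 s2 tens_scale A B (tensor s1 s2)"
  by (auto simp: bilinear_on_def linear_on_def tensor_def fun_scale_def fun_eq_iff)

lemma linear_on_tensor_left:
  "linear_on s s1 A f \<Longrightarrow> linear_on s tens_scale A (\<lambda>x. tensor s1 s2 (f x) b)"
  by (rule linear_on_compose[where B = UNIV and g = "\<lambda>x. tensor s1 s2 x b"])
    (auto intro: bilinear_onD[OF bilinear_on_tensor, of _ UNIV])

lemma linear_on_tensor_right:
  "linear_on s s2 A f \<Longrightarrow> linear_on s tens_scale A (\<lambda>x. tensor s1 s2 a (f x))"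
  by (rule linear_on_compose[where B = UNIV and g = "\<lambda>x. tensor s1 s2 a x"])
    (auto intro: bilinear_onD[OF bilinear_on_tensor, of _ UNIV])

lemma vector_space_tens: "vector_space (tens_scale :: 'k::field \<Rightarrow> ('k, 'a, 'b) tens \<Rightarrow> _)"
  by (intro vector_space_fun_scale vector_space_field)

lemma subspace_tensor_space:
  fixes s1 :: "'k::field \<Rightarrow> 'a::ab_group_add \<Rightarrow> 'a" and s2 :: "'k \<Rightarrow> 'b::ab_group_add \<Rightarrow> 'b"
  shows "module.subspace tens_scale (tensor_space s1 s2 A B)"
proof -
  interpret vector_space "tens_scale :: 'k \<Rightarrow> ('k, 'a, 'b) tens \<Rightarrow> _" by (rule vector_space_tens)
  show ?thesis unfolding tensor_space_def by (rule subspace_span)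
qed

lemma tensor_in_tensor_space:
  fixes s1 :: "'k::field \<Rightarrow> 'a::ab_group_add \<Rightarrow> 'a" and s2 :: "'k \<Rightarrow> 'b::ab_group_add \<Rightarrow> 'b"
  shows "\<lbrakk>a \<in> A; b \<in> B\<rbrakk> \<Longrightarrow> tensor s1 s2 a b \<in> tensor_space s1 s2 A B"
proof -
  interpret vector_space "tens_scale :: 'k \<Rightarrow> ('k, 'a, 'b) tens \<Rightarrow> _" by (rule vector_space_tens)
  show "\<lbrakk>a \<in> A; b \<in> B\<rbrakk> \<Longrightarrow> tensor s1 s2 a b \<in> tensor_space s1 s2 A B"
    unfolding tensor_space_def by (rule span_base) auto
qed

text \<open>The list chosen inside \<open>sweedler\<close>, named so that facts about this choice
  can be stated.\<close>

definition tensor_rep ::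
  "('k::field \<Rightarrow> 'a::ab_group_add \<Rightarrow> 'a) \<Rightarrow> ('k \<Rightarrow> 'b::ab_group_add \<Rightarrow> 'b) \<Rightarrow> 'a set \<Rightarrow> 'b set
    \<Rightarrow> ('k, 'a, 'b) tens \<Rightarrow> ('a \<times> 'b) list"
  where "tensor_rep s1 s2 A B t =
    (SOME xs. set xs \<subseteq> A \<times> B \<and> t = (\<Sum>(a, b)\<leftarrow>xs. tensor s1 s2 a b))"

text \<open>
  The representing list does not depend on \<open>f\<close>, so congruence, additivity in \<open>f\<close> and commutation
  with linear maps hold without bilinearity of \<open>f\<close>.
\<close>

lemma sweedler_eq_sum_list:
  "sweedler s1 s2 A B f t = (\<Sum>p\<leftarrow>tensor_rep s1 s2 A B t. f (fst p) (snd p))"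
  by (simp add: sweedler_def tensor_rep_def Let_def case_prod_unfold)

lemma sweedler_sum:
  "sweedler s1 s2 A B (\<lambda>x y. \<Sum>i\<in>I. f i x y) t = (\<Sum>i\<in>I. sweedler s1 s2 A B (f i) t)"
proof -
  have "(\<Sum>p\<leftarrow>xs. \<Sum>i\<in>I. g i p) = (\<Sum>i\<in>I. \<Sum>p\<leftarrow>xs. g i p)" for xs I and g :: "'x \<Rightarrow> 'y \<Rightarrow> 'z::ab_group_add"
    by (induction xs) (auto simp: sum.distrib)
  then show ?thesis by (simp add: sweedler_eq_sum_list)
qed

text \<open>Two different spaces are allowed because coassociativity lives in (A \<otimes> A)
  \<otimes> A, where the left factor is itself a \<open>tensor_space\<close>.\<close>

locale tensor_pair =
  fixes s1 :: "'k::field \<Rightarrow> 'a::ab_group_add \<Rightarrow> 'a" and s2 :: "'k \<Rightarrow> 'b::ab_group_add \<Rightarrow> 'b"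
    and A :: "'a set" and B :: "'b set"
  assumes vs1: "vector_space s1" and vs2: "vector_space s2"
    and sub1: "module.subspace s1 A" and sub2: "module.subspace s2 B"
begin

lemma tensor_rep:
  assumes "t \<in> tensor_space s1 s2 A B"
  shows "set (tensor_rep s1 s2 A B t) \<subseteq> A \<times> B"
    "(\<Sum>(a, b)\<leftarrow>tensor_rep s1 s2 A B t. tensor s1 s2 a b) = t"
proof -
  from tensor_space_rep[OF vs1 sub1 assms]
  have "\<exists>xs. set xs \<subseteq> A \<times> B \<and> t = (\<Sum>(a, b)\<leftarrow>xs. tensor s1 s2 a b)" by metis
  from someI_ex[OF this] show "set (tensor_rep s1 s2 A B t) \<subseteq> A \<times> B"
    "(\<Sum>(a, b)\<leftarrow>tensor_rep s1 s2 A B t. tensor s1 s2 a b) = t"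
    unfolding tensor_rep_def by auto
qed

lemma sweedler_cong:
  assumes "t \<in> tensor_space s1 s2 A B" "\<And>x y. \<lbrakk>x \<in> A; y \<in> B\<rbrakk> \<Longrightarrow> f x y = g x y"
  shows "sweedler s1 s2 A B f t = sweedler s1 s2 A B g t"
  unfolding sweedler_eq_sum_list
  by (rule arg_cong[of _ _ sum_list], rule map_cong) (use tensor_rep(1)[OF assms(1)] assms(2) in auto)

lemma sweedler_closed:
  assumes "t \<in> tensor_space s1 s2 A B" "vector_space s3" "module.subspace s3 C"
    "\<And>x y. \<lbrakk>x \<in> A; y \<in> B\<rbrakk> \<Longrightarrow> f x y \<in> C"
  shows "sweedler s1 s2 A B f t \<in> C"
  unfolding sweedler_eq_sum_list
  by (rule subspace_sum_list[OF assms(2,3)]) (use tensor_rep(1)[OF assms(1)] assms(4) in auto)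

lemma linear_on_sweedler_image:
  assumes "t \<in> tensor_space s1 s2 A B" "vector_space s3" "module.subspace s3 C"
    "linear_on s3 s4 C \<phi>" "\<And>x y. \<lbrakk>x \<in> A; y \<in> B\<rbrakk> \<Longrightarrow> f x y \<in> C"
  shows "\<phi> (sweedler s1 s2 A B f t) = sweedler s1 s2 A B (\<lambda>x y. \<phi> (f x y)) t"
  unfolding sweedler_eq_sum_list
  by (rule linear_on_sum_list_image[OF assms(2-4)]) (use tensor_rep(1)[OF assms(1)] assms(5) in auto)

lemma linear_on_sweedler_param:
  assumes "t \<in> tensor_space s1 s2 A B" "vector_space s4"
    "\<And>x y. \<lbrakk>x \<in> A; y \<in> B\<rbrakk> \<Longrightarrow> linear_on s3 s4 C (\<lambda>a. f a x y)"
  shows "linear_on s3 s4 C (\<lambda>a. sweedler s1 s2 A B (f a) t)"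
  unfolding sweedler_eq_sum_list
  by (rule linear_on_sum_list[OF assms(2)]) (use tensor_rep(1)[OF assms(1)] assms(3) in auto)

lemma sweedler_tensor:
  assumes "vector_space s3" "bilinear_on s1 s2 s3 A B f" "a \<in> A" "b \<in> B"
  shows "sweedler s1 s2 A B f (tensor s1 s2 a b) = f a b"
  using sweedler_sum_list[OF vs1 vs2 assms(1) sub1 sub2 assms(2), of "[(a, b)]"] assms(3,4) by simp

text \<open>The list chosen for a sum bears no relation to the lists chosen for its summands, so
  bilinearity of \<open>f\<close> enters here: by \<open>sweedler_sum_list\<close> any representing
  list will do, such as the concatenation, or the list with rescaled first entries.\<close>

lemma linear_on_sweedler:
  assumes "vector_space s3" "bilinear_on s1 s2 s3 A B f"
  shows "linear_on tens_scale s3 (tensor_space s1 s2 A B) (sweedler s1 s2 A B f)"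
proof -
  interpret s1: vector_space s1 by (rule vs1)
  interpret s3: vector_space s3 by fact
  interpret T: vector_space "tens_scale :: 'k \<Rightarrow> ('k, 'a, 'b) tens \<Rightarrow> _" by (rule vector_space_tens)
  note ssl = sweedler_sum_list[OF vs1 vs2 assms(1) sub1 sub2 assms(2)]
  show ?thesis
    unfolding linear_on_def
  proof (intro conjI ballI allI)
    fix x y assume x: "x \<in> tensor_space s1 s2 A B" and y: "y \<in> tensor_space s1 s2 A B"
    let ?r = "tensor_rep s1 s2 A B"
    have "x + y = (\<Sum>(a, b)\<leftarrow>?r x @ ?r y. tensor s1 s2 a b)"
      using tensor_rep(2)[OF x] tensor_rep(2)[OF y] by simp
    then have "sweedler s1 s2 A B f (x + y) = (\<Sum>(a, b)\<leftarrow>?r x @ ?r y. f a b)"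
      using tensor_rep(1)[OF x] tensor_rep(1)[OF y] by (simp only:) (intro ssl, auto)
    then show "sweedler s1 s2 A B f (x + y) = sweedler s1 s2 A B f x + sweedler s1 s2 A B f y"
      by (simp add: sweedler_eq_sum_list case_prod_unfold)
  next
    fix c x assume x: "x \<in> tensor_space s1 s2 A B"
    let ?r = "tensor_rep s1 s2 A B x"
    have ten: "tensor s1 s2 (s1 c a) b = tens_scale c (tensor s1 s2 a b)" for a b
      using bilinear_on_tensor[of s1 s2 UNIV UNIV] by (auto simp: bilinear_on_def linear_on_def)
    have "tens_scale c x = (\<Sum>(a, b)\<leftarrow>map (\<lambda>(a, b). (s1 c a, b)) ?r. tensor s1 s2 a b)"
    proof -
      have "tens_scale c (\<Sum>(a, b)\<leftarrow>ys. tensor s1 s2 a b) =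
        (\<Sum>(a, b)\<leftarrow>map (\<lambda>(a, b). (s1 c a, b)) ys. tensor s1 s2 a b)" for ys
      proof (induction ys)
        case (Cons p ys)
        then show ?case
          by (simp only: list.map sum_list.Cons T.scale_right_distrib case_prod_unfold ten fst_conv snd_conv)
      qed (simp only: list.map sum_list.Nil T.scale_zero_right)
      from this[of ?r] show ?thesis by (simp only: tensor_rep(2)[OF x])
    qed
    then have "sweedler s1 s2 A B f (tens_scale c x) =
        (\<Sum>(a, b)\<leftarrow>map (\<lambda>(a, b). (s1 c a, b)) ?r. f a b)"
      using tensor_rep(1)[OF x] by (simp only:) (intro ssl, auto intro!: s1.subspace_scale sub1)
    also have "\<dots> = s3 c (\<Sum>(a, b)\<leftarrow>?r. f a b)"
    proof -
      have "(\<Sum>(a, b)\<leftarrow>map (\<lambda>(a, b). (s1 c a, b)) ys. f a b) = s3 c (\<Sum>(a, b)\<leftarrow>ys. f a b)"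
        if "set ys \<subseteq> A \<times> B" for ys
        using that assms(2)
        by (induction ys) (auto simp: s3.scale_right_distrib bilinear_on_def linear_on_def)
      from this[OF tensor_rep(1)[OF x]] show ?thesis .
    qed
    finally show "sweedler s1 s2 A B f (tens_scale c x) = s3 c (sweedler s1 s2 A B f x)"
      by (simp add: sweedler_eq_sum_list case_prod_unfold)
  qed
qed

end

section \<open>Sweedler sums of coproducts\<close>

definition cosum ::
  "('k::field, 'a::ab_group_add, 'm) hopf_data_scheme \<Rightarrow> ('a \<Rightarrow> 'a \<Rightarrow> 'c::ab_group_add) \<Rightarrow> 'a \<Rightarrow> 'c"
  where "cosum A f x = sw A f (cmul A x)"

lemma cosum_sum: "cosum A (\<lambda>u v. \<Sum>i\<in>I. f i u v) x = (\<Sum>i\<in>I. cosum A (f i) x)"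
  by (simp add: cosum_def sweedler_sum)

sublocale k_space \<subseteq> tensor_pair "scl A" "scl A" "car A" "car A"
  by (intro tensor_pair.intro scale subspace)

lemma (in k_space) car_closed:
  "0 \<in> car A" "\<lbrakk>x \<in> car A; y \<in> car A\<rbrakk> \<Longrightarrow> x + y \<in> car A" "x \<in> car A \<Longrightarrow> scl A c x \<in> car A"
  "(\<And>i. i \<in> I \<Longrightarrow> g i \<in> car A) \<Longrightarrow> (\<Sum>i\<in>I. g i) \<in> car A"
proof -
  interpret vector_space "scl A" by (rule scale)
  show "0 \<in> car A" "\<lbrakk>x \<in> car A; y \<in> car A\<rbrakk> \<Longrightarrow> x + y \<in> car A" "x \<in> car A \<Longrightarrow> scl A c x \<in> car A"
    "(\<And>i. i \<in> I \<Longrightarrow> g i \<in> car A) \<Longrightarrow> (\<Sum>i\<in>I. g i) \<in> car A"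
    using subspace by (auto simp: subspace_0 subspace_add subspace_scale subspace_sum)
qed

text \<open>
  The calculus of products and coproducts is already needed to prove that the biproduct is
  associative and coassociative, hence these two fragments of \<^locale>\<open>k_algebra\<close> and \<^locale>\<open>k_coalgebra\<close>.
\<close>

locale bilinear_product = k_space +
  assumes product_closed: "\<lbrakk>x \<in> car A; y \<in> car A\<rbrakk> \<Longrightarrow> mul A x y \<in> car A"
    and product_bilinear: "bilinear_on (scl A) (scl A) (scl A) (car A) (car A) (mul A)"
begin

lemma linear_on_mul_left:
  assumes "linear_on s (scl A) B f" "\<And>x. x \<in> B \<Longrightarrow> f x \<in> car A" "b \<in> car A"
  shows "linear_on s (scl A) B (\<lambda>x. mul A (f x) b)"
  by (rule linear_on_compose[OF _ assms(1,2)]) (auto intro: bilinear_onD[OF product_bilinear] assms)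

lemma linear_on_mul_right:
  assumes "linear_on s (scl A) B f" "\<And>x. x \<in> B \<Longrightarrow> f x \<in> car A" "b \<in> car A"
  shows "linear_on s (scl A) B (\<lambda>x. mul A b (f x))"
  by (rule linear_on_compose[OF _ assms(1,2)]) (auto intro: bilinear_onD[OF product_bilinear] assms)

lemma mul_sum_left:
  assumes "\<And>i. i \<in> I \<Longrightarrow> f i \<in> car A" "b \<in> car A"
  shows "mul A (\<Sum>i\<in>I. f i) b = (\<Sum>i\<in>I. mul A (f i) b)"
  by (rule linear_on_sum_image[OF scale subspace bilinear_onD(1)[OF product_bilinear]])
    (use assms in auto)

lemma mul_sum_right:
  assumes "\<And>i. i \<in> I \<Longrightarrow> f i \<in> car A" "b \<in> car A"
  shows "mul A b (\<Sum>i\<in>I. f i) = (\<Sum>i\<in>I. mul A b (f i))"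
  by (rule linear_on_sum_image[OF scale subspace bilinear_onD(2)[OF product_bilinear]])
    (use assms in auto)

lemma mul_zero: "b \<in> car A \<Longrightarrow> mul A b 0 = 0" "b \<in> car A \<Longrightarrow> mul A 0 b = 0"
  using linear_on_zero[OF scale subspace bilinear_onD(1)[OF product_bilinear]]
    linear_on_zero[OF scale subspace bilinear_onD(2)[OF product_bilinear]] by auto

lemma mul_scale:
  assumes "a \<in> car A" "b \<in> car A"
  shows "mul A (scl A c a) b = scl A c (mul A a b)" "mul A a (scl A c b) = scl A c (mul A a b)"
  using assms linear_onD(2)[OF bilinear_onD(1)[OF product_bilinear]]
    linear_onD(2)[OF bilinear_onD(2)[OF product_bilinear]] by auto

end

sublocale k_algebra \<subseteq> bilinear_product
  by unfold_locales (auto intro: mul_closed mul_bilinear)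

locale linear_coproduct = k_space +
  assumes coproduct_closed: "x \<in> car A \<Longrightarrow> cmul A x \<in> tensor_space (scl A) (scl A) (car A) (car A)"
    and coproduct_linear: "linear_on (scl A) tens_scale (car A) (cmul A)"
begin

lemma cosum_cong:
  assumes "x \<in> car A" "\<And>u v. \<lbrakk>u \<in> car A; v \<in> car A\<rbrakk> \<Longrightarrow> f u v = g u v"
  shows "cosum A f x = cosum A g x"
  unfolding cosum_def by (rule sweedler_cong) (use assms coproduct_closed in auto)

lemma cosum_closed:
  assumes "x \<in> car A" "vector_space s" "module.subspace s C"
    "\<And>u v. \<lbrakk>u \<in> car A; v \<in> car A\<rbrakk> \<Longrightarrow> f u v \<in> C"
  shows "cosum A f x \<in> C"
  unfolding cosum_def by (rule sweedler_closed[OF _ assms(2,3)]) (use assms coproduct_closed in auto)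

text \<open>Linearity of f(x1, x2) occurs in three roles: an outer map is moved inside (here),
  \<open>f\<close> depends linearly on a parameter (\<open>linear_on_cosum_param\<close>), or the
  argument x varies (\<open>linear_on_cosum\<close>). The last role is the one that asks for
  \<open>f\<close> to be bilinear.\<close>

lemma linear_on_cosum_image:
  assumes "vector_space s3" "module.subspace s3 C" "linear_on s3 s4 C \<phi>"
    "x \<in> car A" "\<And>u v. \<lbrakk>u \<in> car A; v \<in> car A\<rbrakk> \<Longrightarrow> f u v \<in> C"
  shows "\<phi> (cosum A f x) = cosum A (\<lambda>u v. \<phi> (f u v)) x"
  unfolding cosum_def by (rule linear_on_sweedler_image[OF _ assms(1-3)]) (use assms coproduct_closed in auto)

lemma linear_on_cosum_param:
  assumes "vector_space s4" "x \<in> car A"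
    "\<And>u v. \<lbrakk>u \<in> car A; v \<in> car A\<rbrakk> \<Longrightarrow> linear_on s3 s4 C (\<lambda>a. f a u v)"
  shows "linear_on s3 s4 C (\<lambda>a. cosum A (f a) x)"
  unfolding cosum_def by (rule linear_on_sweedler_param) (use assms coproduct_closed in auto)

lemma linear_on_cosum:
  assumes "vector_space s4" "bilinear_on (scl A) (scl A) s4 (car A) (car A) f"
    "linear_on s3 (scl A) C h" "\<And>x. x \<in> C \<Longrightarrow> h x \<in> car A"
  shows "linear_on s3 s4 C (\<lambda>x. cosum A f (h x))"
proof (rule linear_on_compose[where B = "car A" and f = h])
  show "linear_on (scl A) s4 (car A) (cosum A f)"
    unfolding cosum_def[abs_def]
    by (rule linear_on_compose[OF linear_on_sweedler[OF assms(1,2)] coproduct_linear]) (rule coproduct_closed)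
qed (use assms in auto)

end

sublocale k_coalgebra \<subseteq> linear_coproduct
  by unfold_locales (auto intro: cmul_closed cmul_linear)

context k_coalgebra
begin

text \<open>The axiom equates two elements of (A \<otimes> A) \<otimes> A. A trilinear
  \<open>f\<close> factors through this space, and the induced linear map, applied to both elements,
  gives the rule for \<open>f\<close>.\<close>

lemma cosum_coassoc:
  assumes s: "vector_space s" and x: "x \<in> car A"
    and f: "\<And>v w. \<lbrakk>v \<in> car A; w \<in> car A\<rbrakk> \<Longrightarrow> linear_on (scl A) s (car A) (\<lambda>u. f u v w)"
      "\<And>u w. \<lbrakk>u \<in> car A; w \<in> car A\<rbrakk> \<Longrightarrow> linear_on (scl A) s (car A) (\<lambda>v. f u v w)"
      "\<And>u v. \<lbrakk>u \<in> car A; v \<in> car A\<rbrakk> \<Longrightarrow> linear_on (scl A) s (car A) (\<lambda>w. f u v w)"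
  shows "cosum A (\<lambda>x1 x2. cosum A (\<lambda>u v. f u v x2) x1) x =
    cosum A (\<lambda>x1 x2. cosum A (\<lambda>u v. f x1 u v) x2) x"
proof -
  let ?T = "tensor_space (scl A) (scl A) (car A) (car A)"
  interpret P: tensor_pair tens_scale "scl A" ?T "car A"
    by (intro tensor_pair.intro vector_space_tens subspace_tensor_space scale subspace)
  \<comment> \<open>\<open>f\<close> with its first two arguments merged into one element of A
    \<otimes> A; a second application of \<open>sweedler\<close> then yields the induced map
    \<open>?\<Phi>\<close>.\<close>
  define g where "g = (\<lambda>t w. sw A (\<lambda>u v. f u v w) t)"
  have gb: "bilinear_on tens_scale (scl A) s ?T (car A) g"
    unfolding g_def
    by (intro bilinear_onI linear_on_sweedler linear_on_sweedler_param s f) auto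
  note gP = P.sweedler_tensor[OF s gb] and gL = P.linear_on_sweedler[OF s gb]
  let ?\<Phi> = "sweedler tens_scale (scl A) ?T (car A) g"
  let ?U = "tensor_space tens_scale (scl A) ?T (car A)"
  note im = linear_on_cosum_image[OF vector_space_tens subspace_tensor_space gL]
  note cl = cosum_closed[OF _ vector_space_tens subspace_tensor_space] tensor_in_tensor_space
  have ft: "g (tens A u v) w = f u v w" if "u \<in> car A" "v \<in> car A" "w \<in> car A" for u v w
    unfolding g_def by (rule sweedler_tensor[OF s]) (use that in \<open>auto intro!: bilinear_onI f\<close>)
  have "?\<Phi> (cosum A (\<lambda>x1 x2. cosum A (\<lambda>u v. tensor tens_scale (scl A) (tens A u v) x2) x1) x) =
    cosum A (\<lambda>x1 x2. cosum A (\<lambda>u v. f u v x2) x1) x"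
    apply (subst im[OF x])
    subgoal by (auto intro!: cl)
    apply (intro cosum_cong x)
    apply (subst im)
    by (auto intro!: cl cosum_cong simp: gP ft tensor_in_tensor_space)
  moreover
  have "?\<Phi> (cosum A (\<lambda>x1 x2. cosum A (\<lambda>u v. tensor tens_scale (scl A) (tens A x1 u) v) x2) x) =
    cosum A (\<lambda>x1 x2. cosum A (\<lambda>u v. f x1 u v) x2) x"
    apply (subst im[OF x])
    subgoal by (auto intro!: cl)
    apply (intro cosum_cong x)
    apply (subst im)
    by (auto intro!: cl cosum_cong simp: gP ft tensor_in_tensor_space)
  ultimately show ?thesis
    using coassoc[OF x] unfolding cosum_def by metis
qed

lemma cosum_counit:
  assumes "x \<in> car A"
  shows "cosum A (\<lambda>x1 x2. scl A (cuni A x1) x2) x = x" "cosum A (\<lambda>x1 x2. scl A (cuni A x2) x1) x = x"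
  using counit_left[OF assms] counit_right[OF assms] by (auto simp: cosum_def)

end

context hopf_algebra
begin

text \<open>Convolution inverses coincide: S = S * (id * S') = (S * id) * S' = S', with the right
  identity for \<open>S'\<close>, coassociativity, and the left identity for
  \<open>S\<close>.\<close>

lemma is_antipode_unique:
  assumes S: "is_antipode A S" and S': "is_antipode A S'" and x: "x \<in> car A"
  shows "S x = S' x"
proof -
  have cl: "S y \<in> car A" "S' y \<in> car A" if "y \<in> car A" for y
    using that S S' by (auto simp: is_antipode_def)
  have lin: "linear_on (scl A) (scl A) (car A) S" "linear_on (scl A) (scl A) (car A) S'"
    using S S' by (auto simp: is_antipode_def)
  have l: "cosum A (\<lambda>u v. mul A (S u) v) y = scl A (cuni A y) (uni A)" if "y \<in> car A" for y
    using that S by (auto simp: is_antipode_def cosum_def)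
  have r: "cosum A (\<lambda>u v. mul A u (S' v)) y = scl A (cuni A y) (uni A)" if "y \<in> car A" for y
    using that S' by (auto simp: is_antipode_def cosum_def)
  note [simp] = cl mul_closed uni_closed car_closed mul_scale uni_left uni_right
  have "S x = S (cosum A (\<lambda>x1 x2. scl A (cuni A x2) x1) x)"
    by (simp add: cosum_counit x)
  also have "\<dots> = cosum A (\<lambda>x1 x2. scl A (cuni A x2) (S x1)) x"
    by (subst linear_on_cosum_image[OF scale subspace lin(1) x])
      (auto intro!: cosum_cong x simp: linear_onD[OF lin(1)])
  also have "\<dots> = cosum A (\<lambda>x1 x2. mul A (S x1) (cosum A (\<lambda>u v. mul A u (S' v)) x2)) x"
    by (intro cosum_cong x) (simp add: r)
  also have "\<dots> = cosum A (\<lambda>x1 x2. cosum A (\<lambda>u v. mul A (S x1) (mul A u (S' v))) x2) x"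
    by (intro cosum_cong x linear_on_cosum_image[OF scale subspace bilinear_onD(2)[OF mul_bilinear]]) auto
  also have "\<dots> = cosum A (\<lambda>x1 x2. cosum A (\<lambda>u v. mul A (S u) (mul A v (S' x2))) x1) x"
    by (rule cosum_coassoc[symmetric, OF scale x])
      (intro linear_on_mul_left linear_on_mul_right lin linear_on_id; simp)+
  also have "\<dots> = cosum A (\<lambda>x1 x2. cosum A (\<lambda>u v. mul A (mul A (S u) v) (S' x2)) x1) x"
    by (intro cosum_cong x) (simp_all add: mul_assoc)
  also have "\<dots> = cosum A (\<lambda>x1 x2. mul A (cosum A (\<lambda>u v. mul A (S u) v) x1) (S' x2)) x"
    by (intro cosum_cong x linear_on_cosum_image[OF scale subspace bilinear_onD(1)[OF mul_bilinear], symmetric]) auto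
  also have "\<dots> = cosum A (\<lambda>x1 x2. scl A (cuni A x1) (S' x2)) x"
    by (intro cosum_cong x) (simp add: l)
  also have "\<dots> = S' (cosum A (\<lambda>x1 x2. scl A (cuni A x1) x2) x)"
    by (subst linear_on_cosum_image[OF scale subspace lin(2) x])
      (auto intro!: cosum_cong x simp: linear_onD[OF lin(2)])
  also have "\<dots> = S' x" by (simp add: cosum_counit x)
  finally show ?thesis .
qed

lemma antipode_eq:
  assumes "is_antipode A S" "x \<in> car A"
  shows "Defs.antipode A x = S x"
proof -
  have "is_antipode A (Defs.antipode A)"
    unfolding Defs.antipode_def by (rule someI[of "is_antipode A", OF assms(1)])
  then show ?thesis using is_antipode_unique assms by blast
qed

end

section \<open>Functions on a finite group with values in a vector space\<close>

lemma single_apply: "single g a x = (if x = g then a else 0)"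
  by (simp add: single_def)

lemma single_zero: "single g 0 = (0 :: _ \<Rightarrow> 'a::zero)"
  by (simp add: single_def fun_eq_iff)

lemma linear_on_single:
  assumes "vector_space s2" "linear_on s1 s2 A f"
  shows "linear_on s1 (fun_scale s2) A (\<lambda>x. single g (f x))"
proof -
  interpret vector_space s2 by fact
  show ?thesis
    using assms(2) by (auto simp: linear_on_def single_def fun_scale_def fun_eq_iff)
qed

lemma subspace_fun_space:
  assumes "vector_space s" "module.subspace s V"
  shows "module.subspace (fun_scale s) (fun_space T V)"
proof -
  interpret s: vector_space s by fact
  interpret f: vector_space "fun_scale s" by (rule vector_space_fun_scale) fact
  show ?thesis
    using assms(2) unfolding f.subspace_def s.subspace_def fun_space_def
    by (auto simp: fun_scale_def)
qed

lemma single_in_fun_space: "\<lbrakk>g \<in> T; a \<in> V; 0 \<in> V\<rbrakk> \<Longrightarrow> single g a \<in> fun_space T V"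
  by (auto simp: fun_space_def single_def)

lemma fun_space_eq_sum_single:
  fixes p :: "'g \<Rightarrow> 'a::comm_monoid_add"
  assumes "finite T" "p \<in> fun_space T V"
  shows "p = (\<Sum>g\<in>T. single g (p g))"
proof
  fix x
  have "(\<Sum>g\<in>T. single g (p g)) x = (\<Sum>g\<in>T. single g (p g) x)"
    by (induction T rule: infinite_finite_induct) auto
  then show "p x = (\<Sum>g\<in>T. single g (p g)) x"
    using assms by (auto simp: single_apply fun_space_def sum.delta)
qed

lemma sum_fun_apply: "(\<Sum>i\<in>I. f i) x = (\<Sum>i\<in>I. f i x :: 'a::comm_monoid_add)"
  by (induction I rule: infinite_finite_induct) auto

text \<open>The functions \<open>single g a\<close> span. Identities on the biproduct are reduced by
  this, one argument at a time, to elements \<open>a # g\<close>.\<close>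

lemma linear_on_fun_space_eqI:
  assumes "finite T" "vector_space s" "module.subspace s V"
    "linear_on (fun_scale s) s3 (fun_space T V) F" "linear_on (fun_scale s) s3 (fun_space T V) F'"
    "p \<in> fun_space T V" "\<And>g a. \<lbrakk>g \<in> T; a \<in> V\<rbrakk> \<Longrightarrow> F (single g a) = F' (single g a)"
  shows "F p = F' p"
proof -
  interpret vector_space s by fact
  note V = vector_space_fun_scale[OF assms(2)] subspace_fun_space[OF assms(2,3)]
  have s: "single g (p g) \<in> fun_space T V" if "g \<in> T" for g
    using that assms(3,6) by (intro single_in_fun_space) (auto simp: fun_space_def subspace_0)
  have "F p = (\<Sum>g\<in>T. F (single g (p g)))"
    by (subst fun_space_eq_sum_single[OF assms(1,6)]) (intro linear_on_sum_image[OF V assms(4)] s)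
  also have "\<dots> = (\<Sum>g\<in>T. F' (single g (p g)))"
    using assms(6,7) by (intro sum.cong) (auto simp: fun_space_def)
  also have "\<dots> = F' p"
    by (subst (2) fun_space_eq_sum_single[OF assms(1,6)])
      (intro linear_on_sum_image[OF V assms(5), symmetric] s)
  finally show ?thesis .
qed

text \<open>The functions \<open>single t b\<close>, with t in T and b in a basis of V, form a
  basis.\<close>

lemma dim_fun_space:
  fixes s :: "'k::field \<Rightarrow> 'a::ab_group_add \<Rightarrow> 'a"
  assumes "vector_space s" "module.subspace s V" "finite T" "vector_space.dim s V > 0"
  shows "vector_space.dim (fun_scale s) (fun_space T V) = card T * vector_space.dim s V"
proof -
  interpret s: vector_space s by fact
  interpret f: vector_space "fun_scale s" by (rule vector_space_fun_scale) fact
  obtain B where B: "B \<subseteq> V" "s.independent B" "V \<subseteq> s.span B" "card B = s.dim V"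
    using s.basis_exists by metis
  \<comment> \<open>An infinite basis would have cardinality 0, which positivity of the dimension
    excludes.\<close>
  have fB: "finite B" using B(4) assms(4) by (metis card.infinite less_not_refl)
  have V0: "0 \<in> V" by (rule s.subspace_0[OF assms(2)])
  define e where "e = (\<lambda>(t :: 'b, b :: 'a). single t b)"
  have ne: "b \<noteq> 0" if "b \<in> B" for b using B(2) s.dependent_zero that by metis
  have inj: "inj_on e (T \<times> B)"
  proof (rule inj_onI, clarify)
    fix t b t' b' assume "b \<in> B" "b' \<in> B" and eq: "e (t, b) = e (t', b')"
    from fun_cong[OF eq, of t] fun_cong[OF eq, of t'] ne[OF \<open>b \<in> B\<close>]
    show "t = t' \<and> b = b'" by (auto simp: e_def single_apply split: if_splits)
  qed
  have sub: "f.subspace (fun_space T V)" by (rule subspace_fun_space) fact+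
  have 1: "e ` (T \<times> B) \<subseteq> fun_space T V"
    using B(1) V0 by (auto simp: e_def intro!: single_in_fun_space)
  have single_span: "single t v \<in> f.span (e ` (T \<times> B))" if t: "t \<in> T" and v: "v \<in> s.span B" for t v
    using v
  proof (induction rule: s.span_induct_alt)
    case base
    show ?case unfolding single_zero by (rule f.span_zero)
  next
    case (step c x y)
    have "single t (s c x + y) = fun_scale s c (single t x) + single t y"
      by (auto simp: single_def fun_scale_def fun_eq_iff)
    moreover have "single t x \<in> e ` (T \<times> B)" using step t by (force simp: e_def)
    ultimately show ?case using step(2) by (metis f.span_add f.span_scale f.span_base)
  qed
  have 2: "fun_space T V \<subseteq> f.span (e ` (T \<times> B))"
  proof
    fix p assume p: "p \<in> fun_space T V"
    have "(\<Sum>t\<in>T. single t (p t)) \<in> f.span (e ` (T \<times> B))"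
      using p B(3) by (intro f.span_sum single_span) (auto simp: fun_space_def)
    then show "p \<in> f.span (e ` (T \<times> B))"
      using fun_space_eq_sum_single[OF assms(3) p] by simp
  qed
  have 3: "f.independent (e ` (T \<times> B))"
  proof (rule f.independent_if_scalars_zero)
    fix c x assume c: "(\<Sum>x\<in>e ` (T \<times> B). fun_scale s (c x) x) = 0" and x: "x \<in> e ` (T \<times> B)"
    then obtain t b where tb: "t \<in> T" "b \<in> B" "x = e (t, b)" by auto
    have "(\<Sum>(u, v)\<in>T \<times> B. fun_scale s (c (e (u, v))) (e (u, v))) t = 0"
      using fun_cong[OF c, of t] by (simp add: sum.reindex[OF inj] case_prod_unfold)
    then have "(\<Sum>u\<in>T. \<Sum>v\<in>B. fun_scale s (c (e (u, v))) (e (u, v)) t) = 0"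
      by (simp add: sum_fun_apply sum.cartesian_product case_prod_unfold)
    \<comment> \<open>Evaluation at t separates the degrees: functions placed at u \<noteq> t vanish
      there.\<close>
    moreover have "(\<Sum>v\<in>B. fun_scale s (c (e (u, v))) (e (u, v)) t) =
      (if u = t then \<Sum>v\<in>B. s (c (e (t, v))) v else 0)" for u
      by (auto simp: fun_scale_def e_def single_apply)
    ultimately have "(\<Sum>v\<in>B. s (c (e (t, v))) v) = 0"
      using tb(1) assms(3) by simp
    with s.independentD[OF B(2) fB subset_refl this tb(2)] show "c x = 0" by (simp add: tb)
  qed (use fB assms(3) in auto)
  have "f.dim (fun_space T V) = card (e ` (T \<times> B))"
    by (rule f.dim_unique[OF 1 2 3 refl])
  also have "\<dots> = card T * s.dim V"
    by (simp add: card_image[OF inj] card_cartesian_product B(4))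
  finally show ?thesis .
qed

lemma linear_on_bilinear_left:
  assumes "bilinear_on s1 s2 s3 A B f" "linear_on s s1 C h" "\<And>x. x \<in> C \<Longrightarrow> h x \<in> A" "b \<in> B"
  shows "linear_on s s3 C (\<lambda>x. f (h x) b)"
  by (rule linear_on_compose[OF bilinear_onD(1)[OF assms(1,4)] assms(2,3)])

lemma linear_on_bilinear_right:
  assumes "bilinear_on s1 s2 s3 A B f" "linear_on s s2 C h" "\<And>x. x \<in> C \<Longrightarrow> h x \<in> B" "b \<in> A"
  shows "linear_on s s3 C (\<lambda>x. f b (h x))"
  by (rule linear_on_compose[OF bilinear_onD(2)[OF assms(1,4)] assms(2,3)])

section \<open>Coaction sums in Yetter-Drinfeld modules\<close>

context yetter_drinfeld
begin

lemma scale_fun: "vector_space (fun_scale (scl R))"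
  by (rule vector_space_fun_scale[OF scale])

lemma linear_on_act:
  assumes "linear_on s (scl R) B f" "\<And>x. x \<in> B \<Longrightarrow> f x \<in> car R" "g \<in> carrier G"
  shows "linear_on s (scl R) B (\<lambda>x. act R g (f x))"
  by (rule linear_on_compose[OF act_linear[OF assms(3)] assms(1,2)])

lemma linear_on_coact:
  assumes "linear_on s (scl R) B f" "\<And>x. x \<in> B \<Longrightarrow> f x \<in> car R"
  shows "linear_on s (scl R) B (\<lambda>x. coact R (f x) g)"
  by (rule linear_on_fun_apply, rule linear_on_compose[OF coact_linear assms(1,2)])

lemma coact_in_car: "a \<in> car R \<Longrightarrow> coact R a g \<in> car R"
  using coact_closed[of a] car_closed(1) by (cases "g \<in> carrier G") (auto simp: fun_space_def)

text \<open>A family \<open>F\<close> of linear maps evaluates an element of kG \<otimes> R through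
  its coefficients. If the element is given as a sum of terms with degrees \<open>k i\<close>,
  several terms may share a degree; linearity of \<open>F x\<close> separates them. The rules for
  coactions of components, of translates and of products are instances.\<close>

lemma sum_over_single:
  assumes "vector_space s" "\<And>x. x \<in> carrier G \<Longrightarrow> linear_on (scl R) s (car R) (F x)"
    "\<And>i. i \<in> I \<Longrightarrow> k i \<in> carrier G" "\<And>i. i \<in> I \<Longrightarrow> v i \<in> car R"
  shows "(\<Sum>x\<in>carrier G. F x ((\<Sum>i\<in>I. single (k i) (v i)) x)) = (\<Sum>i\<in>I. F (k i) (v i))"
proof -
  have "(\<Sum>x\<in>carrier G. F x ((\<Sum>i\<in>I. single (k i) (v i)) x)) =
    (\<Sum>x\<in>carrier G. F x (\<Sum>i\<in>I. single (k i) (v i) x))"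
    by (simp add: sum_fun_apply)
  also have "\<dots> = (\<Sum>x\<in>carrier G. \<Sum>i\<in>I. F x (single (k i) (v i) x))"
    by (intro sum.cong refl linear_on_sum_image[OF scale subspace assms(2)])
      (use assms(4) car_closed(1) in \<open>auto simp: single_apply\<close>)
  also have "\<dots> = (\<Sum>x\<in>carrier G. \<Sum>i\<in>I. if x = k i then F (k i) (v i) else 0)"
    using linear_on_zero[OF scale subspace assms(2)] by (intro sum.cong) (auto simp: single_apply)
  also have "\<dots> = (\<Sum>i\<in>I. \<Sum>x\<in>carrier G. if x = k i then F (k i) (v i) else 0)"
    by (rule sum.swap)
  also have "\<dots> = (\<Sum>i\<in>I. F (k i) (v i))"
    using assms(3) by (intro sum.cong) (auto simp: finite_group)
  finally show ?thesis .
qed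

lemma sum_coact_coact:
  assumes "vector_space s" "\<And>x. x \<in> carrier G \<Longrightarrow> linear_on (scl R) s (car R) (F x)"
    "a \<in> car R" "g \<in> carrier G"
  shows "(\<Sum>x\<in>carrier G. F x (coact R (coact R a g) x)) = F g (coact R a g)"
  using sum_over_single[OF assms(1,2), where I = "{()}" and k = "\<lambda>_. g" and v = "\<lambda>_. coact R a g"] assms(3,4)
  by (simp add: coact_coassoc coact_in_car)

lemma sum_coact_act:
  assumes "vector_space s" "\<And>x. x \<in> carrier G \<Longrightarrow> linear_on (scl R) s (car R) (F x)"
    "a \<in> car R" "h \<in> carrier G"
  shows "(\<Sum>x\<in>carrier G. F x (coact R (act R h a) x)) =
    (\<Sum>x\<in>carrier G. F (h \<otimes> x \<otimes> inv h) (act R h (coact R a x)))"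
  unfolding coact_act[OF assms(4,3)]
  by (rule sum_over_single[OF assms(1,2)]) (use assms(3,4) in \<open>auto simp: coact_in_car act_closed\<close>)

text \<open>\<open>coact_coassoc\<close> makes the coefficient \<open>coact R a g\<close>
  homogeneous of degree g.\<close>

lemma coact_eq_zero_outside: "\<lbrakk>a \<in> car R; g \<notin> supp G R\<rbrakk> \<Longrightarrow> coact R a g = 0"
proof (cases "g \<in> carrier G")
  case True
  assume a: "a \<in> car R" "g \<notin> supp G R"
  then have "coact R a g \<in> homogeneous R g"
    using True by (simp add: homogeneous_def coact_in_car coact_coassoc)
  with a True show ?thesis by (auto simp: supp_def)
qed (use coact_closed in \<open>auto simp: fun_space_def\<close>)

end

section \<open>Structure axioms as rules for bilinear maps\<close>

context braided_hopf_algebra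
begin

text \<open>The compatibility axioms equate tensors. Applying the linear map induced by
  \<open>f\<close> turns them into rules for f(x1, x2); \<open>cosum_mul\<close> and
  \<open>cosum_coact\<close> arise in the same way from braided multiplicativity and colinearity of
  the coproduct.\<close>

lemma cosum_act:
  assumes "vector_space s" "bilinear_on (scl R) (scl R) s (car R) (car R) f" "g \<in> carrier G" "a \<in> car R"
  shows "cosum R f (act R g a) = cosum R (\<lambda>a1 a2. f (act R g a1) (act R g a2)) a"
proof -
  note lin = linear_on_cosum_image[OF vector_space_tens subspace_tensor_space linear_on_sweedler[OF assms(1,2)]]
  have "cosum R f (act R g a) = sw R f (cosum R (\<lambda>a1 a2. tens R (act R g a1) (act R g a2)) a)"
    using cmul_act[OF assms(3,4)] by (simp add: cosum_def)
  also have "\<dots> = cosum R (\<lambda>a1 a2. sw R f (tens R (act R g a1) (act R g a2))) a"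
    using assms by (intro lin) (auto intro: tensor_in_tensor_space act_closed)
  also have "\<dots> = cosum R (\<lambda>a1 a2. f (act R g a1) (act R g a2)) a"
    using assms by (intro cosum_cong) (auto intro: sweedler_tensor act_closed)
  finally show ?thesis .
qed

lemma cosum_mul:
  assumes "vector_space s" "bilinear_on (scl R) (scl R) s (car R) (car R) f" "a \<in> car R" "b \<in> car R"
  shows "cosum R f (mul R a b) = cosum R (\<lambda>a1 a2. cosum R (\<lambda>b1 b2. \<Sum>g\<in>carrier G.
    f (mul R a1 (act R g b1)) (mul R (coact R a2 g) b2)) b) a"
proof -
  note swl = linear_on_sweedler[OF assms(1,2)]
  note lin = linear_on_cosum_image[OF vector_space_tens subspace_tensor_space swl]
  interpret T: vector_space "tens_scale :: 'k \<Rightarrow> ('k, 'a, 'a) tens \<Rightarrow> _" by (rule vector_space_tens)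
  let ?t = "\<lambda>a1 a2 b1 b2 g. tens R (mul R a1 (act R g b1)) (mul R (coact R a2 g) b2)"
  have cl: "?t a1 a2 b1 b2 g \<in> tensor_space (scl R) (scl R) (car R) (car R)"
    if "a1 \<in> car R" "a2 \<in> car R" "b1 \<in> car R" "b2 \<in> car R" "g \<in> carrier G" for a1 a2 b1 b2 g
    using that by (intro tensor_in_tensor_space mul_closed act_closed coact_in_car)
  have cls: "(\<Sum>g\<in>carrier G. ?t a1 a2 b1 b2 g) \<in> tensor_space (scl R) (scl R) (car R) (car R)"
    if "a1 \<in> car R" "a2 \<in> car R" "b1 \<in> car R" "b2 \<in> car R" for a1 a2 b1 b2
    using that by (intro T.subspace_sum subspace_tensor_space cl)
  have "cosum R f (mul R a b) = sw R f (cosum R (\<lambda>a1 a2. cosum R (\<lambda>b1 b2. \<Sum>g\<in>carrier G. ?t a1 a2 b1 b2 g) b) a)"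
    using braided_cmul_mul[OF assms(3,4)] by (simp add: cosum_def)
  also have "\<dots> = cosum R (\<lambda>a1 a2. sw R f (cosum R (\<lambda>b1 b2. \<Sum>g\<in>carrier G. ?t a1 a2 b1 b2 g) b)) a"
    by (intro lin assms) (intro cosum_closed[OF _ vector_space_tens subspace_tensor_space] assms cls)
  also have "\<dots> = cosum R (\<lambda>a1 a2. cosum R (\<lambda>b1 b2. sw R f (\<Sum>g\<in>carrier G. ?t a1 a2 b1 b2 g)) b) a"
    by (intro lin cosum_cong cls assms)
  also have "\<dots> = cosum R (\<lambda>a1 a2. cosum R (\<lambda>b1 b2. \<Sum>g\<in>carrier G. sw R f (?t a1 a2 b1 b2 g)) b) a"
    by (intro cosum_cong cl linear_on_sum_image[OF vector_space_tens subspace_tensor_space swl] assms)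
  also have "\<dots> = cosum R (\<lambda>a1 a2. cosum R (\<lambda>b1 b2. \<Sum>g\<in>carrier G.
    f (mul R a1 (act R g b1)) (mul R (coact R a2 g) b2)) b) a"
    by (intro cosum_cong sum.cong refl sweedler_tensor[OF assms(1,2)] assms(3,4))
      (auto intro: mul_closed act_closed coact_in_car)
  finally show ?thesis .
qed

lemma cosum_coact:
  assumes "vector_space s" "bilinear_on (scl R) (scl R) s (car R) (car R) f" "x \<in> carrier G" "a \<in> car R"
  shows "cosum R f (coact R a x) = cosum R (\<lambda>a1 a2. \<Sum>g\<in>carrier G. \<Sum>h\<in>carrier G.
    if x = g \<otimes> h then f (coact R a1 g) (coact R a2 h) else 0) a"
proof -
  note swl = linear_on_sweedler[OF assms(1,2)]
  note lin = linear_on_cosum_image[OF vector_space_tens subspace_tensor_space swl]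
  interpret T: vector_space "tens_scale :: 'k \<Rightarrow> ('k, 'a, 'a) tens \<Rightarrow> _" by (rule vector_space_tens)
  let ?t = "\<lambda>a1 a2 g h. if x = g \<otimes> h then tens R (coact R a1 g) (coact R a2 h) else 0"
  have cl: "?t a1 a2 g h \<in> tensor_space (scl R) (scl R) (car R) (car R)"
    if "a1 \<in> car R" "a2 \<in> car R" for a1 a2 g h
    using that by (auto intro: tensor_in_tensor_space coact_in_car T.subspace_0[OF subspace_tensor_space])
  have cl2: "(\<Sum>h\<in>carrier G. ?t a1 a2 g h) \<in> tensor_space (scl R) (scl R) (car R) (car R)"
    if "a1 \<in> car R" "a2 \<in> car R" for a1 a2 g
    using that by (intro T.subspace_sum subspace_tensor_space cl)
  have cl1: "(\<Sum>g\<in>carrier G. \<Sum>h\<in>carrier G. ?t a1 a2 g h) \<in> tensor_space (scl R) (scl R) (car R) (car R)"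
    if "a1 \<in> car R" "a2 \<in> car R" for a1 a2
    using that by (intro T.subspace_sum subspace_tensor_space cl2)
  \<comment> \<open>Colinearity of the coproduct equates functions on G; the value at x isolates the
    coproduct of a single component.\<close>
  have "cmul R (coact R a x) = (\<Sum>g\<in>carrier G. single g (cmul R (coact R a g))) x"
    using assms(3) by (simp add: sum_fun_apply single_apply finite_group)
  also have "\<dots> = cosum R (\<lambda>a1 a2. (\<Sum>g\<in>carrier G. \<Sum>h\<in>carrier G.
              single (g \<otimes> h) (tens R (coact R a1 g) (coact R a2 h)))) a x"
    by (simp add: cmul_coact[OF assms(4)] cosum_def)
  also have "\<dots> = cosum R (\<lambda>a1 a2. \<Sum>g\<in>carrier G. \<Sum>h\<in>carrier G. ?t a1 a2 g h) a"
  proof -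
    have "sum_list (map F xs) x = (\<Sum>p\<leftarrow>xs. F p x)" for F :: "_ \<Rightarrow> 'g \<Rightarrow> ('k, 'a, 'a) tens" and xs
      by (induction xs) auto
    note sl = this
    show ?thesis
      by (simp add: sl cosum_def sweedler_eq_sum_list sum_fun_apply single_apply if_distrib[of "\<lambda>q. q _"] cong: if_cong)
  qed
  finally have "cosum R f (coact R a x) = sw R f (cosum R (\<lambda>a1 a2. \<Sum>g\<in>carrier G. \<Sum>h\<in>carrier G. ?t a1 a2 g h) a)"
    unfolding cosum_def by simp
  also have "\<dots> = cosum R (\<lambda>a1 a2. sw R f (\<Sum>g\<in>carrier G. \<Sum>h\<in>carrier G. ?t a1 a2 g h)) a"
    by (intro lin cl1 assms)
  also have "\<dots> = cosum R (\<lambda>a1 a2. \<Sum>g\<in>carrier G. \<Sum>h\<in>carrier G. sw R f (?t a1 a2 g h)) a"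
    apply (intro cosum_cong assms)
    apply (subst linear_on_sum_image[OF vector_space_tens subspace_tensor_space swl])
     apply (rule cl2; assumption)
    by (intro sum.cong refl linear_on_sum_image[OF vector_space_tens subspace_tensor_space swl] cl)
  also have "\<dots> = cosum R (\<lambda>a1 a2. \<Sum>g\<in>carrier G. \<Sum>h\<in>carrier G.
    if x = g \<otimes> h then f (coact R a1 g) (coact R a2 h) else 0) a"
    using linear_on_zero[OF vector_space_tens subspace_tensor_space swl]
    by (intro cosum_cong sum.cong refl assms(4)) (auto intro!: sweedler_tensor assms(1,2) coact_in_car)
  finally show ?thesis .
qed

text \<open>After summation over all degrees, the constraint x = g h of \<open>cosum_coact\<close>
  merely determines x, so g and h range freely.\<close>

lemma sum_cosum_coact:
  assumes "vector_space s"
    "\<And>x. x \<in> carrier G \<Longrightarrow> bilinear_on (scl R) (scl R) s (car R) (car R) (F x)" "a \<in> car R"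
  shows "(\<Sum>x\<in>carrier G. cosum R (F x) (coact R a x)) = cosum R (\<lambda>a1 a2. \<Sum>g\<in>carrier G. \<Sum>h\<in>carrier G.
    F (g \<otimes> h) (coact R a1 g) (coact R a2 h)) a"
proof -
  have "(\<Sum>x\<in>carrier G. cosum R (F x) (coact R a x)) =
    (\<Sum>x\<in>carrier G. cosum R (\<lambda>a1 a2. \<Sum>g\<in>carrier G. \<Sum>h\<in>carrier G.
      if x = g \<otimes> h then F x (coact R a1 g) (coact R a2 h) else 0) a)"
    using assms by (intro sum.cong cosum_coact) auto
  also have "\<dots> = cosum R (\<lambda>a1 a2. \<Sum>x\<in>carrier G. \<Sum>g\<in>carrier G. \<Sum>h\<in>carrier G.
      if x = g \<otimes> h then F x (coact R a1 g) (coact R a2 h) else 0) a"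
    by (simp add: cosum_sum)
  also have "\<dots> = cosum R (\<lambda>a1 a2. \<Sum>g\<in>carrier G. \<Sum>h\<in>carrier G.
    F (g \<otimes> h) (coact R a1 g) (coact R a2 h)) a"
  proof (intro cosum_cong assms(3))
    fix u v
    have "(\<Sum>x\<in>carrier G. \<Sum>g\<in>carrier G. \<Sum>h\<in>carrier G.
      if x = g \<otimes> h then F x (coact R u g) (coact R v h) else 0) =
      (\<Sum>g\<in>carrier G. \<Sum>x\<in>carrier G. \<Sum>h\<in>carrier G.
      if x = g \<otimes> h then F x (coact R u g) (coact R v h) else 0)" by (rule sum.swap)
    also have "\<dots> = (\<Sum>g\<in>carrier G. \<Sum>h\<in>carrier G. \<Sum>x\<in>carrier G.
      if x = g \<otimes> h then F x (coact R u g) (coact R v h) else 0)"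
      by (intro sum.cong refl sum.swap)
    also have "\<dots> = (\<Sum>g\<in>carrier G. \<Sum>h\<in>carrier G. F (g \<otimes> h) (coact R u g) (coact R v h))"
      by (intro sum.cong refl) (simp add: finite_group)
    finally show "(\<Sum>x\<in>carrier G. \<Sum>g\<in>carrier G. \<Sum>h\<in>carrier G.
      if x = g \<otimes> h then F x (coact R u g) (coact R v h) else 0) =
      (\<Sum>g\<in>carrier G. \<Sum>h\<in>carrier G. F (g \<otimes> h) (coact R u g) (coact R v h))" .
  qed
  finally show ?thesis .
qed

lemma sum_coact_mul:
  assumes "vector_space s" "\<And>x. x \<in> carrier G \<Longrightarrow> linear_on (scl R) s (car R) (F x)"
    "a \<in> car R" "b \<in> car R"
  shows "(\<Sum>x\<in>carrier G. F x (coact R (mul R a b) x)) =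
    (\<Sum>g\<in>carrier G. \<Sum>h\<in>carrier G. F (g \<otimes> h) (mul R (coact R a g) (coact R b h)))"
  unfolding coact_mul[OF assms(3,4)] sum.cartesian_product case_prod_unfold
  by (rule sum_over_single[OF assms(1,2)])
    (use assms(3,4) in \<open>auto intro: mul_closed coact_in_car\<close>)

lemma cuni_coact_apply:
  assumes "a \<in> car R" "g \<in> carrier G"
  shows "cuni R (coact R a g) = (if g = \<one> then cuni R a else 0)"
proof -
  have "cuni R (coact R a g) = (\<Sum>h\<in>carrier G. single h (cuni R (coact R a h))) g"
    using assms(2) by (simp add: sum_fun_apply single_apply finite_group)
  then show ?thesis by (simp add: cuni_coact[OF assms(1)] single_apply)
qed

lemma cosum_uni:
  assumes "vector_space s" "bilinear_on (scl R) (scl R) s (car R) (car R) f"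
  shows "cosum R f (uni R) = f (uni R) (uni R)"
  unfolding cosum_def cmul_uni by (intro sweedler_tensor[OF assms] uni_closed)

section \<open>The biproduct as a Hopf algebra\<close>

abbreviation biprod where "biprod \<equiv> biproduct G R"

lemma car_biprod: "car biprod = fun_space (carrier G) (car R)"
  and scl_biprod: "scl biprod = fun_scale (scl R)"
  and uni_biprod: "uni biprod = single \<one> (uni R)"
  and cuni_biprod: "cuni biprod p = (\<Sum>g\<in>carrier G. cuni R (p g))"
  and mul_biprod: "mul biprod p q =
    (\<Sum>g\<in>carrier G. \<Sum>h\<in>carrier G. single (g \<otimes> h) (mul R (p g) (act R g (q h))))"
  and cmul_biprod: "cmul biprod p = (\<Sum>g\<in>carrier G. cosum R (\<lambda>a1 a2. \<Sum>x\<in>carrier G.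
    tens biprod (single (x \<otimes> g) a1) (single g (coact R a2 x))) (p g))"
  by (simp_all add: biproduct_def cosum_def)

lemma single_in_biprod: "\<lbrakk>g \<in> carrier G; a \<in> car R\<rbrakk> \<Longrightarrow> single g a \<in> car biprod"
  by (simp add: car_biprod single_in_fun_space car_closed)

lemma biprod_apply_in_car: "p \<in> car biprod \<Longrightarrow> p g \<in> car R"
  using car_closed(1) by (cases "g \<in> carrier G") (auto simp: car_biprod fun_space_def)

lemma linear_on_biprod_apply:
  "linear_on s (scl biprod) B f \<Longrightarrow> linear_on s (scl R) B (\<lambda>x. f x g)"
  unfolding scl_biprod by (rule linear_on_fun_apply)

lemma linear_on_single_biprod:
  "linear_on s (scl R) B f \<Longrightarrow> linear_on s (scl biprod) B (\<lambda>x. single g (f x))"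
  unfolding scl_biprod by (rule linear_on_single[OF scale])

lemmas car_intros = mul_closed act_closed coact_in_car single_in_biprod
  m_closed inv_closed one_closed

lemmas lin_intros = linear_on_id linear_on_mul_left linear_on_mul_right linear_on_act linear_on_coact
  linear_on_biprod_apply linear_on_single_biprod linear_on_tensor_left linear_on_tensor_right

lemma k_space_biprod: "k_space biprod"
  unfolding k_space_def car_biprod scl_biprod by (intro conjI scale_fun subspace_fun_space scale subspace)

section \<open>Algebra structure of the biproduct\<close>

sublocale biprod: bilinear_product biprod
proof (intro bilinear_product.intro k_space_biprod bilinear_product_axioms.intro)
  interpret biprod: k_space biprod by (rule k_space_biprod)
  show "mul biprod p q \<in> car biprod" if "p \<in> car biprod" "q \<in> car biprod" for p q
    unfolding mul_biprod using that by (intro biprod.car_closed car_intros biprod_apply_in_car)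
  show "bilinear_on (scl biprod) (scl biprod) (scl biprod) (car biprod) (car biprod) (mul biprod)"
    unfolding mul_biprod
    by (intro bilinear_onI linear_on_sum biprod.scale lin_intros car_intros) (auto intro: biprod_apply_in_car)
qed

lemma biprod_eqI:
  assumes "linear_on (scl biprod) s (car biprod) F" "linear_on (scl biprod) s (car biprod) F'"
    "p \<in> car biprod" "\<And>g a. \<lbrakk>g \<in> carrier G; a \<in> car R\<rbrakk> \<Longrightarrow> F (single g a) = F' (single g a)"
  shows "F p = F' p"
  using linear_on_fun_space_eqI[OF finite_group scale subspace assms(1,2)[unfolded scl_biprod car_biprod] assms(3)[unfolded car_biprod] assms(4)] .

lemma sum_single:
  assumes "g \<in> carrier G" "F g 0 = 0" "\<And>x. x \<in> carrier G \<Longrightarrow> F x 0 = 0"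
  shows "(\<Sum>x\<in>carrier G. F x (single g a x)) = F g a"
proof -
  have "(\<Sum>x\<in>carrier G. F x (single g a x)) = (\<Sum>x\<in>carrier G. if x = g then F g a else 0)"
    using assms by (intro sum.cong) (auto simp: single_apply)
  then show ?thesis using assms(1) by (simp add: finite_group)
qed

lemma act_zero: "g \<in> carrier G \<Longrightarrow> act R g 0 = 0"
  using linear_on_zero[OF scale subspace act_linear] .

lemma mul_biprod_single:
  assumes "g \<in> carrier G" "h \<in> carrier G" "a \<in> car R" "b \<in> car R"
  shows "mul biprod (single g a) (single h b) = single (g \<otimes> h) (mul R a (act R g b))"
proof -
  have "mul biprod (single g a) (single h b) =
    (\<Sum>x\<in>carrier G. single (x \<otimes> h) (mul R (single g a x) (act R x b)))"
    unfolding mul_biprod using assms car_closed(1)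
    by (intro sum.cong refl sum_single) (auto simp: act_zero mul_zero single_zero single_apply)
  also have "\<dots> = single (g \<otimes> h) (mul R a (act R g b))"
    using assms by (intro sum_single) (auto simp: act_closed mul_zero single_zero)
  finally show ?thesis .
qed

lemmas linear_on_mul_biprod = biprod.linear_on_mul_left biprod.linear_on_mul_right

sublocale biprod: k_algebra biprod
proof
  show "uni biprod \<in> car biprod" by (simp add: uni_biprod single_in_biprod uni_closed)
  show "mul biprod p q \<in> car biprod" if "p \<in> car biprod" "q \<in> car biprod" for p q
    by (rule biprod.product_closed) fact+
  show "bilinear_on (scl biprod) (scl biprod) (scl biprod) (car biprod) (car biprod) (mul biprod)"
    by (rule biprod.product_bilinear)
  note cl = biprod.product_closed single_in_biprod
  note ass = mul_biprod_single car_intros act_mul act_mult mul_assoc m_assoc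
  show "mul biprod (mul biprod p q) r = mul biprod p (mul biprod q r)"
    if pqr: "p \<in> car biprod" "q \<in> car biprod" "r \<in> car biprod" for p q r
  proof (rule biprod_eqI[OF _ _ pqr(1)])
    fix g a assume [simp]: "g \<in> carrier G" "a \<in> car R"
    show "mul biprod (mul biprod (single g a) q) r = mul biprod (single g a) (mul biprod q r)"
    proof (rule biprod_eqI[OF _ _ pqr(2)])
      fix h b assume [simp]: "h \<in> carrier G" "b \<in> car R"
      show "mul biprod (mul biprod (single g a) (single h b)) r =
        mul biprod (single g a) (mul biprod (single h b) r)"
      proof (rule biprod_eqI[OF _ _ pqr(3)])
        fix k c assume [simp]: "k \<in> carrier G" "c \<in> car R"
        show "mul biprod (mul biprod (single g a) (single h b)) (single k c) =
          mul biprod (single g a) (mul biprod (single h b) (single k c))"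
          \<comment> \<open>Both sides are a (g.b) (gh.c), placed in degree g h k.\<close>
          by (simp add: ass)
      qed (use pqr in \<open>auto intro!: linear_on_mul_biprod linear_on_id cl\<close>)
    qed (use pqr in \<open>auto intro!: linear_on_mul_biprod linear_on_id cl\<close>)
  qed (use pqr in \<open>auto intro!: linear_on_mul_biprod linear_on_id cl\<close>)
  show "mul biprod (uni biprod) p = p" if "p \<in> car biprod" for p
    by (rule biprod_eqI[OF _ _ that])
      (auto intro!: linear_on_mul_biprod linear_on_id simp: uni_biprod single_in_biprod uni_closed
        mul_biprod_single act_one uni_left)
  show "mul biprod p (uni biprod) = p" if "p \<in> car biprod" for p
    by (rule biprod_eqI[OF _ _ that])
      (auto intro!: linear_on_mul_biprod linear_on_id simp: uni_biprod single_in_biprod uni_closed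
        mul_biprod_single act_uni uni_right)
qed

section \<open>Coalgebra structure of the biproduct\<close>

lemma bilinear_on_cmul_biprod:
  assumes g: "g \<in> carrier G"
    and f: "bilinear_on (scl biprod) (scl biprod) s (car biprod) (car biprod) f" "vector_space s"
  shows "bilinear_on (scl R) (scl R) s (car R) (car R)
    (\<lambda>a1 a2. \<Sum>x\<in>carrier G. f (single (x \<otimes> g) a1) (single g (coact R a2 x)))"
  by (intro bilinear_onI linear_on_sum f(2) linear_on_bilinear_left[OF f(1)]
      linear_on_bilinear_right[OF f(1)] lin_intros car_intros g)

sublocale biprod: linear_coproduct biprod
proof
  interpret T: vector_space "tens_scale :: 'k \<Rightarrow> ('k, 'g \<Rightarrow> 'a, 'g \<Rightarrow> 'a) tens \<Rightarrow> _"
    by (rule vector_space_tens)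
  show "cmul biprod p \<in> tensor_space (scl biprod) (scl biprod) (car biprod) (car biprod)"
    if "p \<in> car biprod" for p
    unfolding cmul_biprod using that
    by (intro T.subspace_sum subspace_tensor_space cosum_closed[OF _ vector_space_tens]
        tensor_in_tensor_space car_intros biprod_apply_in_car[OF that])
  show "linear_on (scl biprod) tens_scale (car biprod) (cmul biprod)"
    unfolding cmul_biprod
    by (intro linear_on_sum vector_space_tens linear_on_cosum bilinear_on_cmul_biprod bilinear_on_tensor
        lin_intros car_intros) (auto intro: biprod_apply_in_car)
qed

lemma cosum_biprod:
  assumes s: "vector_space s" and f: "bilinear_on (scl biprod) (scl biprod) s (car biprod) (car biprod) f"
    and p: "p \<in> car biprod"
  shows "cosum biprod f p = (\<Sum>g\<in>carrier G. cosum R (\<lambda>a1 a2. \<Sum>x\<in>carrier G.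
    f (single (x \<otimes> g) a1) (single g (coact R a2 x))) (p g))"
proof -
  interpret T: vector_space "tens_scale :: 'k \<Rightarrow> ('k, 'g \<Rightarrow> 'a, 'g \<Rightarrow> 'a) tens \<Rightarrow> _"
    by (rule vector_space_tens)
  note swl = biprod.linear_on_sweedler[OF s f]
  let ?F = "sweedler (scl biprod) (scl biprod) (car biprod) (car biprod) f"
  let ?T = "tensor_space (scl biprod) (scl biprod) (car biprod) (car biprod)"
  let ?t = "\<lambda>g a1 a2. \<Sum>x\<in>carrier G. tens biprod (single (x \<otimes> g) a1) (single g (coact R a2 x))"
  have cl: "?t g a1 a2 \<in> ?T" if "g \<in> carrier G" "a1 \<in> car R" "a2 \<in> car R" for g a1 a2
    using that by (intro T.subspace_sum subspace_tensor_space tensor_in_tensor_space car_intros)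
  have "cosum biprod f p = ?F (\<Sum>g\<in>carrier G. cosum R (?t g) (p g))"
    by (simp add: cosum_def[of biprod] cmul_biprod)
  also have "\<dots> = (\<Sum>g\<in>carrier G. ?F (cosum R (?t g) (p g)))"
    by (rule linear_on_sum_image[OF vector_space_tens subspace_tensor_space swl])
      (intro cosum_closed[OF _ vector_space_tens] subspace_tensor_space cl car_intros biprod_apply_in_car[OF p])
  also have "\<dots> = (\<Sum>g\<in>carrier G. cosum R (\<lambda>a1 a2. ?F (?t g a1 a2)) (p g))"
    by (intro sum.cong refl linear_on_cosum_image[OF vector_space_tens subspace_tensor_space swl] cl
        car_intros biprod_apply_in_car[OF p])
  also have "\<dots> = (\<Sum>g\<in>carrier G. cosum R (\<lambda>a1 a2. \<Sum>x\<in>carrier G.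
    ?F (tens biprod (single (x \<otimes> g) a1) (single g (coact R a2 x)))) (p g))"
    by (intro sum.cong refl cosum_cong linear_on_sum_image[OF vector_space_tens subspace_tensor_space swl]
        tensor_in_tensor_space car_intros biprod_apply_in_car[OF p])
  also have "\<dots> = (\<Sum>g\<in>carrier G. cosum R (\<lambda>a1 a2. \<Sum>x\<in>carrier G.
    f (single (x \<otimes> g) a1) (single g (coact R a2 x))) (p g))"
    by (intro sum.cong refl cosum_cong biprod.sweedler_tensor[OF s f] car_intros biprod_apply_in_car[OF p])
  finally show ?thesis .
qed

lemma cosum_biprod_single:
  assumes s: "vector_space s" and f: "bilinear_on (scl biprod) (scl biprod) s (car biprod) (car biprod) f"
    and g: "g \<in> carrier G" and a: "a \<in> car R"
  shows "cosum biprod f (single g a) = cosum R (\<lambda>a1 a2. \<Sum>x\<in>carrier G.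
    f (single (x \<otimes> g) a1) (single g (coact R a2 x))) a"
proof -
  have zero: "cosum R (\<lambda>a1 a2. \<Sum>x\<in>carrier G. f (single (x \<otimes> y) a1) (single y (coact R a2 x))) 0 = 0"
    if "y \<in> carrier G" for y
    by (rule linear_on_zero[OF scale subspace linear_on_cosum[OF s bilinear_on_cmul_biprod[OF that f s] linear_on_id]])
  show ?thesis
    unfolding cosum_biprod[OF s f single_in_biprod[OF g a]] by (intro sum_single g zero)
qed

lemma cuni_zero: "cuni R 0 = 0"
  using linear_on_zero[OF scale subspace cuni_linear] .

lemma cuni_biprod_single: "\<lbrakk>g \<in> carrier G; a \<in> car R\<rbrakk> \<Longrightarrow> cuni biprod (single g a) = cuni R a"
  unfolding cuni_biprod by (intro sum_single) (auto simp: cuni_zero)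

lemma linear_on_cuni_biprod: "linear_on (scl biprod) (*) (car biprod) (cuni biprod)"
  unfolding cuni_biprod[abs_def]
  by (intro linear_on_sum vector_space_field linear_on_compose[OF cuni_linear] linear_on_biprod_apply
      linear_on_id biprod_apply_in_car)

lemma scl_biprod_single: "scl biprod c (single g a) = single g (scl R c a)"
proof -
  interpret vector_space "scl R" by (rule scale)
  show ?thesis by (auto simp: scl_biprod fun_scale_def single_def fun_eq_iff)
qed

lemma single_sum: "(\<Sum>i\<in>I. single g (f i)) = single g (\<Sum>i\<in>I. f i :: 'x::comm_monoid_add)"
  by (auto simp: fun_eq_iff sum_fun_apply single_apply)

lemma cosum_single:
  fixes g :: 'g
  assumes "a \<in> car R" "\<And>u v. \<lbrakk>u \<in> car R; v \<in> car R\<rbrakk> \<Longrightarrow> f u v \<in> car R"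
  shows "cosum R (\<lambda>a1 a2. single g (f a1 a2)) a = single g (cosum R f a)"
proof -
  have "linear_on (scl R) (scl biprod) (car R) (single g)"
    by (rule linear_on_single_biprod[OF linear_on_id])
  from linear_on_cosum_image[OF scale subspace this assms] show ?thesis by simp
qed

text \<open>With \<open>a1 \<otimes> u1 \<otimes> u2\<close> the twofold coproduct, both sides
  become the sum of \<open>a1 # xzg \<otimes> (u1)\<^sub>x # zg \<otimes> (u2)\<^sub>z # g\<close>
  over the degrees x and z. The left side gets there by coassociativity in R. The right side uses
  colinearity of the coproduct, to split the degree of a2 between u1 and u2, and coassociativity of
  the coaction.\<close>

lemma coassoc_biprod:
  assumes p: "p \<in> car biprod"
  shows "cosum biprod (\<lambda>x1 x2. cosum biprod (\<lambda>u v. tensor tens_scale (scl biprod) (tens biprod u v) x2) x1) p =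
    cosum biprod (\<lambda>x1 x2. cosum biprod (\<lambda>u v. tensor tens_scale (scl biprod) (tens biprod x1 u) v) x2) p"
proof -
  let ?t = "\<lambda>u v w. tensor tens_scale (scl biprod) (tens biprod u v) w"
  note lin = linear_on_sum vector_space_tens lin_intros car_intros
  have b: "bilinear_on (scl biprod) (scl biprod) tens_scale (car biprod) (car biprod) (\<lambda>u v. ?t u v w)"
    "bilinear_on (scl biprod) (scl biprod) tens_scale (car biprod) (car biprod) (?t u)" for u w
    by (intro bilinear_onI lin)+
  have "cosum biprod (\<lambda>x1 x2. cosum biprod (\<lambda>u v. ?t u v x2) x1) p =
    (\<Sum>g\<in>carrier G. cosum R (\<lambda>a1 a2. \<Sum>x\<in>carrier G.
      cosum biprod (\<lambda>u v. ?t u v (single g (coact R a2 x))) (single (x \<otimes> g) a1)) (p g))"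
    by (intro cosum_biprod[OF vector_space_tens _ p] bilinear_onI biprod.linear_on_cosum b
        biprod.linear_on_cosum_param lin)
  also have "\<dots> = (\<Sum>g\<in>carrier G. cosum R (\<lambda>a1 a2. \<Sum>x\<in>carrier G. cosum R (\<lambda>u1 u2. \<Sum>y\<in>carrier G.
      ?t (single (y \<otimes> (x \<otimes> g)) u1) (single (x \<otimes> g) (coact R u2 y)) (single g (coact R a2 x))) a1) (p g))"
    by (intro sum.cong refl cosum_cong cosum_biprod_single[OF vector_space_tens b(1)] car_intros biprod_apply_in_car[OF p])
  also have "\<dots> = (\<Sum>g\<in>carrier G. cosum R (\<lambda>a1 a2. cosum R (\<lambda>u1 u2. \<Sum>x\<in>carrier G. \<Sum>y\<in>carrier G.
      ?t (single (y \<otimes> (x \<otimes> g)) u1) (single (x \<otimes> g) (coact R u2 y)) (single g (coact R a2 x))) a1) (p g))"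
    by (simp add: cosum_sum)
  also have "\<dots> = (\<Sum>g\<in>carrier G. cosum R (\<lambda>a1 a2. cosum R (\<lambda>u1 u2. \<Sum>x\<in>carrier G. \<Sum>y\<in>carrier G.
      ?t (single (y \<otimes> (x \<otimes> g)) a1) (single (x \<otimes> g) (coact R u1 y)) (single g (coact R u2 x))) a2) (p g))"
    by (intro sum.cong refl cosum_coassoc[OF vector_space_tens] lin biprod_apply_in_car[OF p])
  also have "\<dots> = (\<Sum>g\<in>carrier G. cosum R (\<lambda>a1 a2. \<Sum>x\<in>carrier G. cosum R (\<lambda>u1 u2. \<Sum>y\<in>carrier G.
      ?t (single (x \<otimes> g) a1) (single (y \<otimes> g) u1) (single g (coact R u2 y))) (coact R a2 x)) (p g))"
  proof (intro sum.cong refl cosum_cong biprod_apply_in_car[OF p])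
    fix g a1 a2 assume g: "g \<in> carrier G" and a: "a1 \<in> car R" "a2 \<in> car R"
    \<comment> \<open>Computed from the nested side: the degree of a2 becomes the product x z of the
      degrees of u1 and u2, and the second coaction on u2 then forces y = z.\<close>
    have "(\<Sum>x\<in>carrier G. cosum R (\<lambda>u1 u2. \<Sum>y\<in>carrier G.
      ?t (single (x \<otimes> g) a1) (single (y \<otimes> g) u1) (single g (coact R u2 y))) (coact R a2 x)) =
      cosum R (\<lambda>u1 u2. \<Sum>x\<in>carrier G. \<Sum>z\<in>carrier G. \<Sum>y\<in>carrier G.
      ?t (single (x \<otimes> z \<otimes> g) a1) (single (y \<otimes> g) (coact R u1 x)) (single g (coact R (coact R u2 z) y))) a2"
      by (intro sum_cosum_coact[OF vector_space_tens] bilinear_onI lin a)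
    also have "\<dots> = cosum R (\<lambda>u1 u2. \<Sum>x\<in>carrier G. \<Sum>z\<in>carrier G.
      ?t (single (x \<otimes> z \<otimes> g) a1) (single (z \<otimes> g) (coact R u1 x)) (single g (coact R u2 z))) a2"
      by (intro cosum_cong sum.cong refl sum_coact_coact[OF vector_space_tens] lin a)
    also have "\<dots> = cosum R (\<lambda>u1 u2. \<Sum>z\<in>carrier G. \<Sum>x\<in>carrier G.
      ?t (single (x \<otimes> (z \<otimes> g)) a1) (single (z \<otimes> g) (coact R u1 x)) (single g (coact R u2 z))) a2"
      by (subst sum.swap) (intro cosum_cong sum.cong refl a, simp_all add: m_assoc g)
    finally show "cosum R (\<lambda>u1 u2. \<Sum>z\<in>carrier G. \<Sum>x\<in>carrier G.
      ?t (single (x \<otimes> (z \<otimes> g)) a1) (single (z \<otimes> g) (coact R u1 x)) (single g (coact R u2 z))) a2 =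
      (\<Sum>x\<in>carrier G. cosum R (\<lambda>u1 u2. \<Sum>y\<in>carrier G.
      ?t (single (x \<otimes> g) a1) (single (y \<otimes> g) u1) (single g (coact R u2 y))) (coact R a2 x))" ..
  qed
  also have "\<dots> = (\<Sum>g\<in>carrier G. cosum R (\<lambda>a1 a2. \<Sum>x\<in>carrier G.
      cosum biprod (\<lambda>u v. ?t (single (x \<otimes> g) a1) u v) (single g (coact R a2 x))) (p g))"
    by (intro sum.cong refl cosum_cong cosum_biprod_single[OF vector_space_tens b(2), symmetric] car_intros
        biprod_apply_in_car[OF p])
  also have "\<dots> = cosum biprod (\<lambda>x1 x2. cosum biprod (\<lambda>u v. ?t x1 u v) x2) p"
    by (intro cosum_biprod[OF vector_space_tens _ p, symmetric] bilinear_onI biprod.linear_on_cosum b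
        biprod.linear_on_cosum_param lin)
  finally show ?thesis .
qed

sublocale biprod: k_coalgebra biprod
proof
  show "cmul biprod p \<in> tensor_space (scl biprod) (scl biprod) (car biprod) (car biprod)"
    if "p \<in> car biprod" for p by (rule biprod.coproduct_closed) fact
  show "linear_on (scl biprod) tens_scale (car biprod) (cmul biprod)"
    by (rule biprod.coproduct_linear)
  show "linear_on (scl biprod) (*) (car biprod) (cuni biprod)" by (rule linear_on_cuni_biprod)
  show "sw biprod (\<lambda>x1 x2. sw biprod (\<lambda>u v. tensor tens_scale (scl biprod) (tens biprod u v) x2) (cmul biprod x1)) (cmul biprod p) =
    sw biprod (\<lambda>x1 x2. sw biprod (\<lambda>u v. tensor tens_scale (scl biprod) (tens biprod x1 u) v) (cmul biprod x2)) (cmul biprod p)"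
    if "p \<in> car biprod" for p
    using coassoc_biprod[OF that] by (simp add: cosum_def)
  have b: "bilinear_on (scl biprod) (scl biprod) (scl biprod) (car biprod) (car biprod)
      (\<lambda>x1 x2. scl biprod (cuni biprod x1) x2)"
    "bilinear_on (scl biprod) (scl biprod) (scl biprod) (car biprod) (car biprod)
      (\<lambda>x1 x2. scl biprod (cuni biprod x2) x1)"
    by (intro bilinear_onI linear_on_scale_left linear_on_scale_right biprod.scale linear_on_id
        linear_on_cuni_biprod)+
  interpret V: vector_space "scl R" by (rule scale)
  show "sw biprod (\<lambda>x1 x2. scl biprod (cuni biprod x1) x2) (cmul biprod p) = p"
    if p: "p \<in> car biprod" for p
    unfolding cosum_def[symmetric]
  proof (rule biprod_eqI[OF _ _ p, where s = "scl biprod"])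
    fix g a assume g: "g \<in> carrier G" and a: "a \<in> car R"
    \<comment> \<open>The counit forgets the degree x g of the first factor, so the components of a2
      add up to a2 by \<open>coact_counit\<close>.\<close>
    have "cosum biprod (\<lambda>x1 x2. scl biprod (cuni biprod x1) x2) (single g a) =
      cosum R (\<lambda>a1 a2. single g (scl R (cuni R a1) a2)) a"
      unfolding cosum_biprod_single[OF biprod.scale b(1) g a]
      by (intro cosum_cong a)
        (simp add: cuni_biprod_single g scl_biprod_single single_sum
          coact_counit V.scale_sum_right[symmetric])
    then show "cosum biprod (\<lambda>x1 x2. scl biprod (cuni biprod x1) x2) (single g a) = single g a"
      by (simp add: cosum_single a car_closed cosum_counit)
  qed (rule biprod.linear_on_cosum[OF biprod.scale b(1) linear_on_id], assumption, rule linear_on_id)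
  show "sw biprod (\<lambda>x1 x2. scl biprod (cuni biprod x2) x1) (cmul biprod p) = p"
    if p: "p \<in> car biprod" for p
    unfolding cosum_def[symmetric]
  proof (rule biprod_eqI[OF _ _ p, where s = "scl biprod"])
    fix g a assume g: "g \<in> carrier G" and a: "a \<in> car R"
    \<comment> \<open>The counit vanishes on components of a2 in degrees other than 1, so the first
      factor keeps degree g.\<close>
    have "cosum biprod (\<lambda>x1 x2. scl biprod (cuni biprod x2) x1) (single g a) =
      cosum R (\<lambda>a1 a2. single g (scl R (cuni R a2) a1)) a"
      unfolding cosum_biprod_single[OF biprod.scale b(2) g a]
      by (intro cosum_cong a)
        (simp add: cuni_biprod_single g scl_biprod_single coact_in_car cuni_coact_apply single_zero
          if_distrib[of "\<lambda>c. scl R c _"] if_distrib[of "single _"] finite_group cong: if_cong)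
    then show "cosum biprod (\<lambda>x1 x2. scl biprod (cuni biprod x2) x1) (single g a) = single g a"
      by (simp add: cosum_single a car_closed cosum_counit)
  qed (rule biprod.linear_on_cosum[OF biprod.scale b(2) linear_on_id], assumption, rule linear_on_id)
qed

lemma cmul_biprod_single:
  assumes g: "g \<in> carrier G" and a: "a \<in> car R"
  shows "cmul biprod (single g a) = cosum R (\<lambda>a1 a2. \<Sum>x\<in>carrier G.
    tens biprod (single (x \<otimes> g) a1) (single g (coact R a2 x))) a"
proof -
  let ?F = "\<lambda>y. cosum R (\<lambda>a1 a2. \<Sum>x\<in>carrier G. tens biprod (single (x \<otimes> y) a1) (single y (coact R a2 x)))"
  have "?F y 0 = 0" if "y \<in> carrier G" for y
    by (rule linear_on_zero[OF scale subspace linear_on_cosum[OF vector_space_tens _ linear_on_id]])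
      (intro bilinear_on_cmul_biprod bilinear_on_tensor vector_space_tens that)
  from sum_single[OF g, of ?F a, OF this[OF g] this] show ?thesis
    by (simp add: cmul_biprod)
qed

text \<open>On \<open>a # g\<close> and \<open>b # h\<close> the axioms enter in this order: braided
  multiplicativity, G-linearity of the coproduct, colinearity of the product, coassociativity of the
  coaction, and the Yetter-Drinfeld compatibility, whose conjugation by g cancels against the group
  factor g h: \<open>y (g z g\<^sup>-\<^sup>1) g h = y g z h\<close>.\<close>

lemma cmul_biprod_mul:
  assumes p: "p \<in> car biprod" and q: "q \<in> car biprod"
  shows "cmul biprod (mul biprod p q) =
    cosum biprod (\<lambda>x1 x2. cosum biprod (\<lambda>y1 y2. tens biprod (mul biprod x1 y1) (mul biprod x2 y2)) q) p"
proof -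
  note lin = linear_on_sum vector_space_tens linear_on_mul_biprod lin_intros car_intros biprod.mul_closed
  let ?t = "\<lambda>x1 x2 y1 y2. tens biprod (mul biprod x1 y1) (mul biprod x2 y2)"
  have b1: "bilinear_on (scl biprod) (scl biprod) tens_scale (car biprod) (car biprod)
    (\<lambda>y1 y2. ?t x1 x2 y1 y2)" if "x1 \<in> car biprod" "x2 \<in> car biprod" for x1 x2
    using that by (intro bilinear_onI lin)
  have b2: "bilinear_on (scl biprod) (scl biprod) tens_scale (car biprod) (car biprod)
    (\<lambda>x1 x2. cosum biprod (\<lambda>y1 y2. ?t x1 x2 y1 y2) q)" if "q \<in> car biprod" for q
    using that by (intro bilinear_onI biprod.linear_on_cosum_param lin)
  have cm: "linear_on s tens_scale C (\<lambda>x. cmul biprod (h x))"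
    if "linear_on s (scl biprod) C h" "\<And>x. x \<in> C \<Longrightarrow> h x \<in> car biprod" for s C and h :: "'y::ab_group_add \<Rightarrow> _"
    by (rule linear_on_compose[OF biprod.cmul_linear that])
  show ?thesis
  proof (rule biprod_eqI[OF _ _ p, where s = tens_scale])
    fix g a assume g: "g \<in> carrier G" and a: "a \<in> car R"
    show "cmul biprod (mul biprod (single g a) q) =
      cosum biprod (\<lambda>x1 x2. cosum biprod (\<lambda>y1 y2. ?t x1 x2 y1 y2) q) (single g a)"
    proof (rule biprod_eqI[OF _ _ q, where s = tens_scale])
      fix h b assume h: "h \<in> carrier G" and b: "b \<in> car R"
      \<comment> \<open>\<open>T k l c d\<close> is \<open>c # k \<otimes> d # l\<close>; kept
        folded, it exposes only the linear dependence on c and d.\<close>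
      define T where "T = (\<lambda>k l c d. tens biprod (single k c) (single l d))"
      have T: "linear_on s (scl R) B f \<Longrightarrow> linear_on s tens_scale B (\<lambda>x. T k l (f x) d)"
        "linear_on s (scl R) B f \<Longrightarrow> linear_on s tens_scale B (\<lambda>x. T k l c (f x))" for s B f k l c d
        by (simp_all add: T_def linear_on_tensor_left linear_on_tensor_right linear_on_single_biprod)
      note lin' = linear_on_sum vector_space_tens T lin_intros car_intros
      have "cmul biprod (mul biprod (single g a) (single h b)) =
        cosum R (\<lambda>c1 c2. \<Sum>x\<in>carrier G. T (x \<otimes> (g \<otimes> h)) (g \<otimes> h) c1 (coact R c2 x)) (mul R a (act R g b))"
        by (simp add: mul_biprod_single cmul_biprod_single T_def car_intros g h a b)
      also have "\<dots> = cosum R (\<lambda>a1 a2. cosum R (\<lambda>b1 b2. \<Sum>y\<in>carrier G. \<Sum>x\<in>carrier G.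
        T (x \<otimes> (g \<otimes> h)) (g \<otimes> h) (mul R a1 (act R y b1)) (coact R (mul R (coact R a2 y) b2) x)) (act R g b)) a"
        by (intro cosum_mul[OF vector_space_tens] bilinear_onI lin' a b g h)
      also have "\<dots> = cosum R (\<lambda>a1 a2. cosum R (\<lambda>b1 b2. \<Sum>y\<in>carrier G. \<Sum>x\<in>carrier G.
        T (x \<otimes> (g \<otimes> h)) (g \<otimes> h) (mul R a1 (act R y (act R g b1)))
          (coact R (mul R (coact R a2 y) (act R g b2)) x)) b) a"
        by (intro cosum_cong cosum_act[OF vector_space_tens] bilinear_onI lin' a b g h)
      also have "\<dots> = cosum R (\<lambda>a1 a2. cosum R (\<lambda>b1 b2. \<Sum>y\<in>carrier G. \<Sum>z\<in>carrier G.
        T (y \<otimes> g \<otimes> z \<otimes> h) (g \<otimes> h) (mul R a1 (act R (y \<otimes> g) b1)) (mul R (coact R a2 y) (act R g (coact R b2 z)))) b) a"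
      proof (intro cosum_cong a b, rule sum.cong[OF refl])
        fix a1 a2 b1 b2 y
        assume c: "a1 \<in> car R" "a2 \<in> car R" "b1 \<in> car R" "b2 \<in> car R" "y \<in> carrier G"
        let ?d = "mul R a1 (act R y (act R g b1))"
        have "(\<Sum>x\<in>carrier G. T (x \<otimes> (g \<otimes> h)) (g \<otimes> h) ?d (coact R (mul R (coact R a2 y) (act R g b2)) x)) =
          (\<Sum>k\<in>carrier G. \<Sum>l\<in>carrier G. T (k \<otimes> l \<otimes> (g \<otimes> h)) (g \<otimes> h) ?d
            (mul R (coact R (coact R a2 y) k) (coact R (act R g b2) l)))"
          by (intro sum_coact_mul[OF vector_space_tens] lin' c g h)
        \<comment> \<open>The component \<open>coact R a2 y\<close> is homogeneous, so only k = y
          remains.\<close>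
        also have "\<dots> = (\<Sum>l\<in>carrier G. T (y \<otimes> l \<otimes> (g \<otimes> h)) (g \<otimes> h) ?d
            (mul R (coact R a2 y) (coact R (act R g b2) l)))"
          by (rule sum_coact_coact[OF vector_space_tens _ c(2,5)]) (intro lin' c g h)
        also have "\<dots> = (\<Sum>l\<in>carrier G. T (y \<otimes> (g \<otimes> l \<otimes> inv g) \<otimes> (g \<otimes> h)) (g \<otimes> h) ?d
            (mul R (coact R a2 y) (act R g (coact R b2 l))))"
          by (rule sum_coact_act[OF vector_space_tens _ c(4) g]) (intro lin' c g h)
        also have "\<dots> = (\<Sum>z\<in>carrier G. T (y \<otimes> g \<otimes> z \<otimes> h) (g \<otimes> h) (mul R a1 (act R (y \<otimes> g) b1))
            (mul R (coact R a2 y) (act R g (coact R b2 z))))"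
        proof (intro sum.cong refl)
          fix z assume z: "z \<in> carrier G"
          have "y \<otimes> (g \<otimes> z \<otimes> inv g) \<otimes> (g \<otimes> h) = y \<otimes> g \<otimes> z \<otimes> (inv g \<otimes> g) \<otimes> h"
            using c g h z by (simp only: m_assoc m_closed inv_closed)
          then show "T (y \<otimes> (g \<otimes> z \<otimes> inv g) \<otimes> (g \<otimes> h)) (g \<otimes> h) ?d (mul R (coact R a2 y) (act R g (coact R b2 z))) =
            T (y \<otimes> g \<otimes> z \<otimes> h) (g \<otimes> h) (mul R a1 (act R (y \<otimes> g) b1)) (mul R (coact R a2 y) (act R g (coact R b2 z)))"
            using c g h z by (simp add: act_mult)
        qed
        finally show "(\<Sum>x\<in>carrier G. T (x \<otimes> (g \<otimes> h)) (g \<otimes> h) ?d (coact R (mul R (coact R a2 y) (act R g b2)) x)) =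
          (\<Sum>z\<in>carrier G. T (y \<otimes> g \<otimes> z \<otimes> h) (g \<otimes> h) (mul R a1 (act R (y \<otimes> g) b1))
            (mul R (coact R a2 y) (act R g (coact R b2 z))))" .
      qed
      also have "\<dots> = cosum R (\<lambda>a1 a2. cosum R (\<lambda>b1 b2. \<Sum>y\<in>carrier G. \<Sum>z\<in>carrier G.
        ?t (single (y \<otimes> g) a1) (single g (coact R a2 y)) (single (z \<otimes> h) b1) (single h (coact R b2 z))) b) a"
        by (intro cosum_cong sum.cong refl a b)
          (simp add: T_def mul_biprod_single g h coact_in_car m_assoc)
      also have "\<dots> = cosum R (\<lambda>a1 a2. \<Sum>y\<in>carrier G. cosum R (\<lambda>b1 b2. \<Sum>z\<in>carrier G.
        ?t (single (y \<otimes> g) a1) (single g (coact R a2 y)) (single (z \<otimes> h) b1) (single h (coact R b2 z))) b) a"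
        by (simp add: cosum_sum)
      also have "\<dots> = cosum R (\<lambda>a1 a2. \<Sum>y\<in>carrier G.
        cosum biprod (\<lambda>y1 y2. ?t (single (y \<otimes> g) a1) (single g (coact R a2 y)) y1 y2) (single h b)) a"
        by (intro cosum_cong sum.cong refl cosum_biprod_single[OF vector_space_tens b1, symmetric] car_intros a b g h)
      also have "\<dots> = cosum biprod (\<lambda>x1 x2. cosum biprod (\<lambda>y1 y2. ?t x1 x2 y1 y2) (single h b)) (single g a)"
        by (intro cosum_biprod_single[OF vector_space_tens b2, symmetric] car_intros a b g h)
      finally show "cmul biprod (mul biprod (single g a) (single h b)) =
        cosum biprod (\<lambda>x1 x2. cosum biprod (\<lambda>y1 y2. ?t x1 x2 y1 y2) (single h b)) (single g a)" .
    next
      show "linear_on (scl biprod) tens_scale (car biprod) (\<lambda>q. cmul biprod (mul biprod (single g a) q))"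
        by (intro cm lin g a)
      show "linear_on (scl biprod) tens_scale (car biprod)
        (\<lambda>q. cosum biprod (\<lambda>x1 x2. cosum biprod (\<lambda>y1 y2. ?t x1 x2 y1 y2) q) (single g a))"
        by (intro biprod.linear_on_cosum_param biprod.linear_on_cosum b1 lin g a)
    qed
  next
    show "linear_on (scl biprod) tens_scale (car biprod) (\<lambda>p. cmul biprod (mul biprod p q))"
      by (intro cm lin q)
    show "linear_on (scl biprod) tens_scale (car biprod)
      (cosum biprod (\<lambda>x1 x2. cosum biprod (\<lambda>y1 y2. ?t x1 x2 y1 y2) q))"
      by (rule biprod.linear_on_cosum[OF vector_space_tens b2[OF q] linear_on_id])
  qed
qed

text \<open>
  \<open>S(a # g) = (1 # (a\<^sub>-\<^sub>1 g)\<^sup>-\<^sup>1)(S(a\<^sub>0) # 1)\<close>.  Colinearity of the antipode \<open>S\<close> of \<open>R\<close> is not an axiom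
  here; with this order of the factors the antipode identities only use that \<open>\<Delta>\<close> is colinear.
\<close>

definition biprod_antipode :: "('a \<Rightarrow> 'a) \<Rightarrow> ('g \<Rightarrow> 'a) \<Rightarrow> 'g \<Rightarrow> 'a"
  where "biprod_antipode S p = (\<Sum>g\<in>carrier G. \<Sum>x\<in>carrier G.
    single (inv (x \<otimes> g)) (act R (inv (x \<otimes> g)) (S (coact R (p g) x))))"

lemma coact_zero: "coact R 0 g = 0"
  using linear_on_zero[OF scale subspace coact_linear] by simp

section \<open>The antipode of the biproduct\<close>

context
  fixes S
  assumes S: "is_antipode R S"
begin

lemma antipode_in_car: "a \<in> car R \<Longrightarrow> S a \<in> car R"
  and antipode_linear: "linear_on (scl R) (scl R) (car R) S"
  and antipode_left: "a \<in> car R \<Longrightarrow> cosum R (\<lambda>u v. mul R (S u) v) a = scl R (cuni R a) (uni R)"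
  and antipode_right: "a \<in> car R \<Longrightarrow> cosum R (\<lambda>u v. mul R u (S v)) a = scl R (cuni R a) (uni R)"
  using S by (auto simp: is_antipode_def cosum_def)

lemma antipode_zero: "S 0 = 0"
  using linear_on_zero[OF scale subspace antipode_linear] .

lemma linear_on_antipode:
  "\<lbrakk>linear_on s (scl R) B f; \<And>x. x \<in> B \<Longrightarrow> f x \<in> car R\<rbrakk> \<Longrightarrow> linear_on s (scl R) B (\<lambda>x. S (f x))"
  by (rule linear_on_compose[OF antipode_linear])

lemma biprod_antipode_single:
  assumes "g \<in> carrier G" "a \<in> car R"
  shows "biprod_antipode S (single g a) =
    (\<Sum>x\<in>carrier G. single (inv (x \<otimes> g)) (act R (inv (x \<otimes> g)) (S (coact R a x))))"
  unfolding biprod_antipode_def using assms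
  by (intro sum_single[where F = "\<lambda>g a. \<Sum>x\<in>carrier G. single (inv (x \<otimes> g)) (act R (inv (x \<otimes> g)) (S (coact R a x)))"])
    (auto intro!: sum.neutral simp: coact_zero antipode_zero act_zero single_zero)

text \<open>The second factors in the coproduct of \<open>a # g\<close> have this form. Such a
  factor is paired with a first factor of degree x g, and its antipode has exactly the inverse
  degree.\<close>

lemma biprod_antipode_single_coact:
  assumes "g \<in> carrier G" "a \<in> car R" "x \<in> carrier G"
  shows "biprod_antipode S (single g (coact R a x)) =
    single (inv (x \<otimes> g)) (act R (inv (x \<otimes> g)) (S (coact R a x)))"
  unfolding biprod_antipode_single[OF assms(1) coact_in_car[OF assms(2)]]
  by (rule sum_coact_coact[OF biprod.scale _ assms(2,3)])
    (intro lin_intros linear_on_antipode antipode_in_car car_intros assms)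

lemma biprod_antipode_closed: "p \<in> car biprod \<Longrightarrow> biprod_antipode S p \<in> car biprod"
  unfolding biprod_antipode_def
  by (intro biprod.car_closed car_intros antipode_in_car) (auto intro: biprod_apply_in_car)

lemma linear_on_biprod_antipode: "linear_on (scl biprod) (scl biprod) (car biprod) (biprod_antipode S)"
  unfolding biprod_antipode_def[abs_def]
  by (intro linear_on_sum biprod.scale lin_intros linear_on_antipode antipode_in_car car_intros)
    (auto intro: biprod_apply_in_car)

lemma linear_on_biprod_antipode':
  "\<lbrakk>linear_on s (scl biprod) B f; \<And>x. x \<in> B \<Longrightarrow> f x \<in> car biprod\<rbrakk>
    \<Longrightarrow> linear_on s (scl biprod) B (\<lambda>x. biprod_antipode S (f x))"
  by (rule linear_on_compose[OF linear_on_biprod_antipode])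

lemma bilinear_biprod_antipode:
  "bilinear_on (scl biprod) (scl biprod) (scl biprod) (car biprod) (car biprod)
    (\<lambda>x1 x2. mul biprod (biprod_antipode S x1) x2)"
  "bilinear_on (scl biprod) (scl biprod) (scl biprod) (car biprod) (car biprod)
    (\<lambda>x1 x2. mul biprod x1 (biprod_antipode S x2))"
  by (intro bilinear_onI linear_on_mul_biprod linear_on_biprod_antipode' biprod_antipode_closed linear_on_id; assumption)+

text \<open>The degrees y of a1 and x of a2 fix the group elements only through the product y x, so
  by colinearity of the coproduct the sum runs over the components of a itself. On each component
  the left identity for \<open>S\<close> applies, and the counit leaves only degree 1.\<close>

lemma biprod_antipode_left:
  assumes p: "p \<in> car biprod"
  shows "cosum biprod (\<lambda>x1 x2. mul biprod (biprod_antipode S x1) x2) p = scl biprod (cuni biprod p) (uni biprod)"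
proof (rule biprod_eqI[OF _ _ p, where s = "scl biprod"])
  fix g a assume g: "g \<in> carrier G" and a: "a \<in> car R"
  let ?i = "\<lambda>z. inv (z \<otimes> g)"
  interpret V: vector_space "scl R" by (rule scale)
  have "cosum biprod (\<lambda>x1 x2. mul biprod (biprod_antipode S x1) x2) (single g a) =
    cosum R (\<lambda>a1 a2. \<Sum>x\<in>carrier G. mul biprod (biprod_antipode S (single (x \<otimes> g) a1)) (single g (coact R a2 x))) a"
    by (rule cosum_biprod_single[OF biprod.scale bilinear_biprod_antipode(1) g a])
  also have "\<dots> = cosum R (\<lambda>a1 a2. \<Sum>x\<in>carrier G. \<Sum>y\<in>carrier G.
      single (?i (y \<otimes> x) \<otimes> g) (act R (?i (y \<otimes> x)) (mul R (S (coact R a1 y)) (coact R a2 x)))) a"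
  proof (intro cosum_cong a, rule sum.cong[OF refl])
    fix a1 a2 x assume c: "a1 \<in> car R" "a2 \<in> car R" "x \<in> carrier G"
    have "mul biprod (biprod_antipode S (single (x \<otimes> g) a1)) (single g (coact R a2 x)) =
      (\<Sum>y\<in>carrier G. mul biprod (single (inv (y \<otimes> (x \<otimes> g))) (act R (inv (y \<otimes> (x \<otimes> g))) (S (coact R a1 y))))
        (single g (coact R a2 x)))"
      using c g by (subst biprod_antipode_single) (auto intro!: biprod.mul_sum_left car_intros antipode_in_car)
    also have "\<dots> = (\<Sum>y\<in>carrier G. single (?i (y \<otimes> x) \<otimes> g)
      (act R (?i (y \<otimes> x)) (mul R (S (coact R a1 y)) (coact R a2 x))))"
      using c g by (intro sum.cong refl) (simp add: mul_biprod_single antipode_in_car coact_in_car act_closed act_mul m_assoc)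
    finally show "mul biprod (biprod_antipode S (single (x \<otimes> g) a1)) (single g (coact R a2 x)) =
      (\<Sum>y\<in>carrier G. single (?i (y \<otimes> x) \<otimes> g)
      (act R (?i (y \<otimes> x)) (mul R (S (coact R a1 y)) (coact R a2 x))))" .
  qed
  \<comment> \<open>The degree of a1 is brought outermost to match
    \<open>sum_cosum_coact\<close>.\<close>
  also have "\<dots> = cosum R (\<lambda>a1 a2. \<Sum>y\<in>carrier G. \<Sum>x\<in>carrier G.
      single (?i (y \<otimes> x) \<otimes> g) (act R (?i (y \<otimes> x)) (mul R (S (coact R a1 y)) (coact R a2 x)))) a"
    by (subst sum.swap) simp
  also have "\<dots> = (\<Sum>z\<in>carrier G. cosum R (\<lambda>u v. single (?i z \<otimes> g) (act R (?i z) (mul R (S u) v))) (coact R a z))"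
    by (rule sum_cosum_coact[OF biprod.scale _ a, symmetric])
      (intro bilinear_onI lin_intros linear_on_antipode antipode_in_car car_intros g)
  also have "\<dots> = (\<Sum>z\<in>carrier G. single (?i z \<otimes> g) (act R (?i z) (cosum R (\<lambda>u v. mul R (S u) v) (coact R a z))))"
  proof (intro sum.cong refl)
    fix z assume z: "z \<in> carrier G"
    have "cosum R (\<lambda>u v. single (?i z \<otimes> g) (act R (?i z) (mul R (S u) v))) (coact R a z) =
      single (?i z \<otimes> g) (cosum R (\<lambda>u v. act R (?i z) (mul R (S u) v)) (coact R a z))"
      by (intro cosum_single car_intros antipode_in_car a z g)
    also have "cosum R (\<lambda>u v. act R (?i z) (mul R (S u) v)) (coact R a z) =
      act R (?i z) (cosum R (\<lambda>u v. mul R (S u) v) (coact R a z))"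
      by (rule linear_on_cosum_image[OF scale subspace act_linear, symmetric])
        (intro car_intros antipode_in_car a z g)+
    finally show "cosum R (\<lambda>u v. single (?i z \<otimes> g) (act R (?i z) (mul R (S u) v))) (coact R a z) =
      single (?i z \<otimes> g) (act R (?i z) (cosum R (\<lambda>u v. mul R (S u) v) (coact R a z)))" .
  qed
  also have "\<dots> = (\<Sum>z\<in>carrier G. if z = \<one> then scl biprod (cuni R a) (uni biprod) else 0)"
  proof (intro sum.cong refl)
    fix z assume z: "z \<in> carrier G"
    have "act R (?i z) (scl R c (uni R)) = scl R c (uni R)" for c
      using linear_onD(2)[OF act_linear uni_closed] z g by (simp add: act_uni)
    then show "single (?i z \<otimes> g) (act R (?i z) (cosum R (\<lambda>u v. mul R (S u) v) (coact R a z))) =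
      (if z = \<one> then scl biprod (cuni R a) (uni biprod) else 0)"
      using z g a by (auto simp: antipode_left coact_in_car cuni_coact_apply scl_biprod_single uni_biprod single_zero)
  qed
  also have "\<dots> = scl biprod (cuni biprod (single g a)) (uni biprod)"
    by (simp add: finite_group cuni_biprod_single g a)
  finally show "cosum biprod (\<lambda>x1 x2. mul biprod (biprod_antipode S x1) x2) (single g a) =
    scl biprod (cuni biprod (single g a)) (uni biprod)" .
next
  show "linear_on (scl biprod) (scl biprod) (car biprod) (cosum biprod (\<lambda>x1 x2. mul biprod (biprod_antipode S x1) x2))"
    by (rule biprod.linear_on_cosum[OF biprod.scale bilinear_biprod_antipode(1) linear_on_id])
  show "linear_on (scl biprod) (scl biprod) (car biprod) (\<lambda>p. scl biprod (cuni biprod p) (uni biprod))"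
    by (rule linear_on_scale_left[OF biprod.scale linear_on_cuni_biprod])
qed

text \<open>The degree x g cancels against its inverse, and so do the two actions. What remains is
  \<open>a1 S((a2)\<^sub>x)\<close> in degree 1, and summation over x restores a2.\<close>

lemma biprod_antipode_right:
  assumes p: "p \<in> car biprod"
  shows "cosum biprod (\<lambda>x1 x2. mul biprod x1 (biprod_antipode S x2)) p = scl biprod (cuni biprod p) (uni biprod)"
proof (rule biprod_eqI[OF _ _ p, where s = "scl biprod"])
  fix g a assume g: "g \<in> carrier G" and a: "a \<in> car R"
  have "cosum biprod (\<lambda>x1 x2. mul biprod x1 (biprod_antipode S x2)) (single g a) =
    cosum R (\<lambda>a1 a2. \<Sum>x\<in>carrier G. mul biprod (single (x \<otimes> g) a1) (biprod_antipode S (single g (coact R a2 x)))) a"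
    by (rule cosum_biprod_single[OF biprod.scale bilinear_biprod_antipode(2) g a])
  also have "\<dots> = cosum R (\<lambda>a1 a2. \<Sum>x\<in>carrier G. single \<one> (mul R a1 (S (coact R a2 x)))) a"
    using g a
    by (intro cosum_cong sum.cong refl)
      (simp_all add: biprod_antipode_single_coact mul_biprod_single car_intros antipode_in_car act_mult[symmetric] act_one)
  also have "\<dots> = cosum R (\<lambda>a1 a2. single \<one> (mul R a1 (S a2))) a"
  proof (intro cosum_cong a)
    fix a1 a2 assume c: "a1 \<in> car R" "a2 \<in> car R"
    have "(\<Sum>x\<in>carrier G. mul R a1 (S (coact R a2 x))) = mul R a1 (\<Sum>x\<in>carrier G. S (coact R a2 x))"
      using c by (intro mul_sum_right[symmetric] antipode_in_car car_intros)
    also have "(\<Sum>x\<in>carrier G. S (coact R a2 x)) = S (\<Sum>x\<in>carrier G. coact R a2 x)"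
      using c by (intro linear_on_sum_image[OF scale subspace antipode_linear, symmetric] car_intros)
    finally show "(\<Sum>x\<in>carrier G. single \<one> (mul R a1 (S (coact R a2 x)))) = single \<one> (mul R a1 (S a2))"
      using c by (simp add: single_sum coact_counit)
  qed
  also have "\<dots> = scl biprod (cuni biprod (single g a)) (uni biprod)"
    by (simp add: cosum_single antipode_in_car mul_closed a antipode_right cuni_biprod_single g uni_biprod scl_biprod_single)
  finally show "cosum biprod (\<lambda>x1 x2. mul biprod x1 (biprod_antipode S x2)) (single g a) =
    scl biprod (cuni biprod (single g a)) (uni biprod)" .
next
  show "linear_on (scl biprod) (scl biprod) (car biprod) (cosum biprod (\<lambda>x1 x2. mul biprod x1 (biprod_antipode S x2)))"
    by (rule biprod.linear_on_cosum[OF biprod.scale bilinear_biprod_antipode(2) linear_on_id])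
  show "linear_on (scl biprod) (scl biprod) (car biprod) (\<lambda>p. scl biprod (cuni biprod p) (uni biprod))"
    by (rule linear_on_scale_left[OF biprod.scale linear_on_cuni_biprod])
qed

lemma is_antipode_biprod: "is_antipode biprod (biprod_antipode S)"
  using biprod_antipode_left biprod_antipode_right biprod_antipode_closed linear_on_biprod_antipode
  by (auto simp: is_antipode_def cosum_def)

end

sublocale biprod: hopf_algebra biprod
proof
  show "cmul biprod (mul biprod p q) =
      sw biprod (\<lambda>x1 x2. sw biprod (\<lambda>y1 y2. tens biprod (mul biprod x1 y1) (mul biprod x2 y2)) (cmul biprod q)) (cmul biprod p)"
    if "p \<in> car biprod" "q \<in> car biprod" for p q
    using cmul_biprod_mul[OF that] by (simp add: cosum_def)
  have "cmul biprod (uni biprod) = (\<Sum>x\<in>carrier G. tens biprod (single x (uni R)) (single \<one> (coact R (uni R) x)))"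
    unfolding uni_biprod cmul_biprod_single[OF one_closed uni_closed]
    by (subst cosum_uni[OF vector_space_tens
          bilinear_on_cmul_biprod[OF one_closed bilinear_on_tensor vector_space_tens]]) simp
  also have "\<dots> = tens biprod (uni biprod) (uni biprod)"
    unfolding coact_uni uni_biprod
    by (intro sum_single[where F = "\<lambda>x b. tens biprod (single x (uni R)) (single \<one> b)"])
      (auto simp: single_zero linear_on_zero[OF biprod.scale biprod.subspace linear_on_tensor_right[OF linear_on_id]])
  finally show "cmul biprod (uni biprod) = tens biprod (uni biprod) (uni biprod)" .
  show "cuni biprod (uni biprod) = 1"
    by (simp add: uni_biprod cuni_biprod_single uni_closed cuni_uni)
  have vf: "vector_space ((*) :: 'k \<Rightarrow> 'k \<Rightarrow> 'k)" by (rule vector_space_field)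
  show "cuni biprod (mul biprod p q) = cuni biprod p * cuni biprod q"
    if p: "p \<in> car biprod" and q: "q \<in> car biprod" for p q
  proof (rule biprod_eqI[OF _ _ p, where s = "(*)"])
    fix g a assume g: "g \<in> carrier G" and a: "a \<in> car R"
    show "cuni biprod (mul biprod (single g a) q) = cuni biprod (single g a) * cuni biprod q"
    proof (rule biprod_eqI[OF _ _ q, where s = "(*)"])
      fix h b assume h: "h \<in> carrier G" and b: "b \<in> car R"
      show "cuni biprod (mul biprod (single g a) (single h b)) = cuni biprod (single g a) * cuni biprod (single h b)"
        by (simp add: g h a b mul_biprod_single cuni_biprod_single car_intros cuni_mul cuni_act)
    next
      show "linear_on (scl biprod) (*) (car biprod) (\<lambda>q. cuni biprod (mul biprod (single g a) q))"
        by (intro linear_on_compose[OF linear_on_cuni_biprod] linear_on_mul_biprod linear_on_id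
            biprod.mul_closed single_in_biprod g a)
      show "linear_on (scl biprod) (*) (car biprod) (\<lambda>q. cuni biprod (single g a) * cuni biprod q)"
        by (intro linear_on_scale_right vf linear_on_cuni_biprod)
    qed
  next
    show "linear_on (scl biprod) (*) (car biprod) (\<lambda>p. cuni biprod (mul biprod p q))"
      by (intro linear_on_compose[OF linear_on_cuni_biprod] linear_on_mul_biprod linear_on_id
          biprod.mul_closed q)
    show "linear_on (scl biprod) (*) (car biprod) (\<lambda>p. cuni biprod p * cuni biprod q)"
      by (intro linear_on_scale_left vf linear_on_cuni_biprod)
  qed
  show "\<exists>S. is_antipode biprod S"
    using antipode is_antipode_biprod by blast
qed

section \<open>Biproducts over normal subgroups\<close>

context
  fixes T
  assumes T: "T \<lhd> G" and supp: "supp G R \<subseteq> T"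
begin

lemma T_in_carrier: "t \<in> T \<Longrightarrow> t \<in> carrier G"
  using normal_imp_subgroup[OF T] subgroup.subset by blast

lemma T_subgroup: "\<one> \<in> T" "\<lbrakk>s \<in> T; t \<in> T\<rbrakk> \<Longrightarrow> s \<otimes> t \<in> T" "t \<in> T \<Longrightarrow> inv t \<in> T"
  using normal_imp_subgroup[OF T] by (auto simp: subgroup.one_closed subgroup.m_closed subgroup.m_inv_closed)

lemma biproduct_sub_closed:
  "0 \<in> biproduct_sub T R"
  "(\<And>i. i \<in> I \<Longrightarrow> f i \<in> biproduct_sub T R) \<Longrightarrow> (\<Sum>i\<in>I. f i) \<in> biproduct_sub T R"
  "\<lbrakk>t \<in> T; a \<in> car R\<rbrakk> \<Longrightarrow> single t a \<in> biproduct_sub T R"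
  "p \<in> biproduct_sub T R \<Longrightarrow> p \<in> car biprod"
proof -
  interpret V: vector_space "fun_scale (scl R)" by (rule scale_fun)
  note sub = subspace_fun_space[OF scale subspace]
  show "0 \<in> biproduct_sub T R"
    "(\<And>i. i \<in> I \<Longrightarrow> f i \<in> biproduct_sub T R) \<Longrightarrow> (\<Sum>i\<in>I. f i) \<in> biproduct_sub T R"
    unfolding biproduct_sub_def by (intro V.subspace_0 V.subspace_sum sub; assumption)+
  show "\<lbrakk>t \<in> T; a \<in> car R\<rbrakk> \<Longrightarrow> single t a \<in> biproduct_sub T R"
    by (simp add: biproduct_sub_def single_in_fun_space car_closed)
  show "p \<in> car biprod" if p: "p \<in> biproduct_sub T R"
  proof -
    have "p g \<in> car R" for g
      using p car_closed(1) by (cases "g \<in> T") (auto simp: biproduct_sub_def fun_space_def)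
    then show ?thesis
      using p T_in_carrier by (auto simp: biproduct_sub_def car_biprod fun_space_def)
  qed
qed

lemma sub_apply_zero: "\<lbrakk>p \<in> biproduct_sub T R; g \<notin> T\<rbrakk> \<Longrightarrow> p g = 0"
  by (auto simp: biproduct_sub_def fun_space_def)

lemma coact_zero_outside: "\<lbrakk>a \<in> car R; g \<notin> T\<rbrakk> \<Longrightarrow> coact R a g = 0"
  using coact_eq_zero_outside supp by blast

lemma mul_sub_closed:
  assumes p: "p \<in> biproduct_sub T R" and q: "q \<in> biproduct_sub T R"
  shows "mul biprod p q \<in> biproduct_sub T R"
  unfolding mul_biprod
proof (intro biproduct_sub_closed(2))
  fix g h assume gh: "g \<in> carrier G" "h \<in> carrier G"
  note pq = biprod_apply_in_car[OF biproduct_sub_closed(4)[OF p]] biprod_apply_in_car[OF biproduct_sub_closed(4)[OF q]]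
  show "single (g \<otimes> h) (mul R (p g) (act R g (q h))) \<in> biproduct_sub T R"
  proof (cases "g \<in> T \<and> h \<in> T")
    case True
    then show ?thesis using gh pq by (intro biproduct_sub_closed(3) T_subgroup car_intros) auto
  next
    case False
    then show ?thesis
      using gh pq sub_apply_zero[OF p] sub_apply_zero[OF q]
      by (auto simp: act_zero mul_zero act_closed single_zero biproduct_sub_closed(1))
  qed
qed

lemma cmul_sub_closed:
  assumes p: "p \<in> biproduct_sub T R"
  shows "cmul biprod p \<in> tensor_space (scl biprod) (scl biprod) (biproduct_sub T R) (biproduct_sub T R)"
    (is "_ \<in> ?T")
proof -
  interpret V: vector_space "tens_scale :: 'k \<Rightarrow> ('k, 'g \<Rightarrow> 'a, 'g \<Rightarrow> 'a) tens \<Rightarrow> _"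
    by (rule vector_space_tens)
  have "cosum R (\<lambda>a1 a2. \<Sum>x\<in>carrier G. tens biprod (single (x \<otimes> g) a1) (single g (coact R a2 x))) (p g) \<in> ?T"
    if g: "g \<in> carrier G" for g
  proof (cases "g \<in> T")
    case True
    have "tens biprod (single (x \<otimes> g) a1) (single g (coact R a2 x)) \<in> ?T"
      if "x \<in> carrier G" "a1 \<in> car R" "a2 \<in> car R" for x a1 a2
    proof (cases "x \<in> T")
      case x: True
      then show ?thesis
        using that True by (intro tensor_in_tensor_space biproduct_sub_closed T_subgroup car_intros) auto
    next
      case False
      then have "coact R a2 x = 0" using that by (simp add: coact_zero_outside)
      moreover have "tens biprod u 0 = 0" for u
        by (rule linear_on_zero[OF biprod.scale biprod.subspace linear_on_tensor_right[OF linear_on_id]])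
      ultimately show ?thesis
        by (simp add: single_zero V.subspace_0[OF subspace_tensor_space])
    qed
    then show ?thesis
      by (intro cosum_closed[OF _ vector_space_tens] biprod_apply_in_car[OF biproduct_sub_closed(4)[OF p]]
          subspace_tensor_space V.subspace_sum)
  next
    case False
    have "cosum R (\<lambda>a1 a2. \<Sum>x\<in>carrier G. tens biprod (single (x \<otimes> g) a1) (single g (coact R a2 x))) 0 = 0"
      by (rule linear_on_zero[OF scale subspace linear_on_cosum[OF vector_space_tens _ linear_on_id]])
        (intro bilinear_on_cmul_biprod bilinear_on_tensor vector_space_tens g)
    then show ?thesis
      using False by (simp add: sub_apply_zero[OF p] V.subspace_0[OF subspace_tensor_space])
  qed
  then show ?thesis
    unfolding cmul_biprod by (intro V.subspace_sum subspace_tensor_space)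
qed

lemma biprod_antipode_sub_closed:
  assumes S: "is_antipode R S" and p: "p \<in> biproduct_sub T R"
  shows "biprod_antipode S p \<in> biproduct_sub T R"
  unfolding biprod_antipode_def
proof (intro biproduct_sub_closed(2))
  fix g x assume gx: "g \<in> carrier G" "x \<in> carrier G"
  note pg = biprod_apply_in_car[OF biproduct_sub_closed(4)[OF p], of g]
  show "single (inv (x \<otimes> g)) (act R (inv (x \<otimes> g)) (S (coact R (p g) x))) \<in> biproduct_sub T R"
  proof (cases "g \<in> T \<and> x \<in> T")
    case True
    then show ?thesis using gx pg by (intro biproduct_sub_closed(3) T_subgroup car_intros antipode_in_car[OF S]) auto
  next
    case False
    then have "coact R (p g) x = 0"
      using coact_zero_outside[OF pg] sub_apply_zero[OF p] coact_zero by auto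
    then show ?thesis using gx by (simp add: antipode_zero[OF S] act_zero single_zero biproduct_sub_closed(1))
  qed
qed

text \<open>Here T is used as a normal subgroup and not only as a subgroup: the product has degrees
  \<open>y t y\<^sup>-\<^sup>1\<close>. The coefficients a and b can be arbitrary because membership
  in \<open>biproduct_sub T R\<close> restricts only degrees.\<close>

lemma conj_sub_closed:
  assumes "y \<in> carrier G" "a \<in> car R" "b \<in> car R" "p \<in> biproduct_sub T R"
  shows "mul biprod (mul biprod (single y a) p) (single (inv y) b) \<in> biproduct_sub T R"
proof -
  note pt = biprod_apply_in_car[OF biproduct_sub_closed(4)[OF assms(4)]]
  have fT: "finite T" using T_in_carrier finite_group by (meson finite_subset subsetI)
  have "mul biprod (single y a) p = (\<Sum>t\<in>T. mul biprod (single y a) (single t (p t)))"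
    by (subst fun_space_eq_sum_single[OF fT assms(4)[unfolded biproduct_sub_def]])
      (intro biprod.mul_sum_right car_intros T_in_carrier pt assms)
  then have "mul biprod (mul biprod (single y a) p) (single (inv y) b) =
    (\<Sum>t\<in>T. mul biprod (mul biprod (single y a) (single t (p t))) (single (inv y) b))"
    by (simp only:) (intro biprod.mul_sum_left biprod.mul_closed car_intros T_in_carrier pt assms)
  also have "\<dots> = (\<Sum>t\<in>T. single (y \<otimes> t \<otimes> inv y) (mul R (mul R a (act R y (p t))) (act R (y \<otimes> t) b)))"
    using assms T_in_carrier pt by (intro sum.cong refl) (simp add: mul_biprod_single car_intros)
  also have "\<dots> \<in> biproduct_sub T R"
    by (intro biproduct_sub_closed normal.inv_op_closed2[OF T] car_intros pt assms) (simp_all add: T_in_carrier assms)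
  finally show ?thesis .
qed

lemma normal_hopf_subalgebra_biproduct_sub: "normal_hopf_subalgebra (biproduct_sub T R) biprod"
proof -
  obtain S where S: "is_antipode R S" using antipode by blast
  note anti = biprod.antipode_eq[OF is_antipode_biprod[OF S]]
  have "left_adjoint biprod h p \<in> biproduct_sub T R"
    if h: "h \<in> car biprod" and p: "p \<in> biproduct_sub T R" for h p
  proof -
    note p' = biproduct_sub_closed(4)[OF p]
    have sub: "module.subspace (scl biprod) (biproduct_sub T R)"
      unfolding biproduct_sub_def scl_biprod by (rule subspace_fun_space[OF scale subspace])
    have "left_adjoint biprod h p =
      cosum biprod (\<lambda>h1 h2. mul biprod (mul biprod h1 p) (biprod_antipode S h2)) h"
      unfolding left_adjoint_def cosum_def[symmetric] by (intro biprod.cosum_cong h) (simp add: anti)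
    \<comment> \<open>The first factor has degree y = x g and the antipode of the second has degree
      inverse to y, so each term has the form treated in \<open>conj_sub_closed\<close>.\<close>
    also have "\<dots> = (\<Sum>g\<in>carrier G. cosum R (\<lambda>a1 a2. \<Sum>x\<in>carrier G.
      mul biprod (mul biprod (single (x \<otimes> g) a1) p) (biprod_antipode S (single g (coact R a2 x)))) (h g))"
      by (intro cosum_biprod[OF biprod.scale _ h] bilinear_onI linear_on_mul_biprod
          linear_on_biprod_antipode'[OF S] biprod_antipode_closed[OF S] linear_on_id biprod.mul_closed p')
    also have "\<dots> \<in> biproduct_sub T R"
    proof (intro biproduct_sub_closed(2) cosum_closed[OF _ biprod.scale sub] biprod_apply_in_car[OF h])
      fix g a1 a2 x
      assume "g \<in> carrier G" "a1 \<in> car R" "a2 \<in> car R" "x \<in> carrier G"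
      then show "mul biprod (mul biprod (single (x \<otimes> g) a1) p) (biprod_antipode S (single g (coact R a2 x)))
        \<in> biproduct_sub T R"
        by (subst biprod_antipode_single_coact[OF S]) (auto intro!: conj_sub_closed car_intros antipode_in_car[OF S] p)
    qed
    finally show ?thesis .
  qed
  moreover have "hopf_subalgebra (biproduct_sub T R) biprod"
    unfolding hopf_subalgebra_def
  proof (intro conjI ballI)
    show "module.subspace (scl biprod) (biproduct_sub T R)"
      unfolding biproduct_sub_def scl_biprod by (rule subspace_fun_space[OF scale subspace])
    show "uni biprod \<in> biproduct_sub T R"
      by (simp add: uni_biprod biproduct_sub_closed T_subgroup uni_closed)
    show "Defs.antipode biprod p \<in> biproduct_sub T R" if "p \<in> biproduct_sub T R" for p
      using that biproduct_sub_closed(4) biprod_antipode_sub_closed[OF S] by (simp add: anti)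
  qed (use biproduct_sub_closed(4) mul_sub_closed cmul_sub_closed biprod.hopf_algebra_axioms in auto)
  ultimately show ?thesis by (simp add: normal_hopf_subalgebra_def)
qed

end

section \<open>The support of a semisimple braided Hopf algebra\<close>

lemma uni_homogeneous: "uni R \<in> homogeneous R \<one>"
  by (simp add: homogeneous_def uni_closed coact_uni)

lemma uni_nonzero: "uni R \<noteq> 0"
  using cuni_uni cuni_zero by force

lemma mul_homogeneous:
  assumes "r \<in> homogeneous R g" "s \<in> homogeneous R h" "g \<in> carrier G" "h \<in> carrier G"
  shows "mul R r s \<in> homogeneous R (g \<otimes> h)"
proof -
  have rs: "r \<in> car R" "s \<in> car R" "coact R r = single g r" "coact R s = single h s"
    using assms by (auto simp: homogeneous_def)
  have "coact R (mul R r s) = (\<Sum>x\<in>carrier G. \<Sum>y\<in>carrier G. single (x \<otimes> y) (mul R (single g r x) (single h s y)))"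
    using rs by (simp add: coact_mul)
  also have "\<dots> = (\<Sum>x\<in>carrier G. single (x \<otimes> h) (mul R (single g r x) s))"
    using rs(1) car_closed(1) assms(4)
    by (intro sum.cong refl sum_single) (auto simp: single_apply mul_zero single_zero)
  also have "\<dots> = single (g \<otimes> h) (mul R r s)"
    using rs(2) assms(3) by (intro sum_single) (auto simp: mul_zero single_zero)
  finally show ?thesis by (simp add: homogeneous_def rs mul_closed)
qed

lemma act_homogeneous:
  assumes "r \<in> homogeneous R g" "g \<in> carrier G" "h \<in> carrier G"
  shows "act R h r \<in> homogeneous R (h \<otimes> g \<otimes> inv h)"
proof -
  have r: "r \<in> car R" "coact R r = single g r" using assms by (auto simp: homogeneous_def)
  have "coact R (act R h r) = (\<Sum>x\<in>carrier G. single (h \<otimes> x \<otimes> inv h) (act R h (single g r x)))"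
    using coact_act[OF assms(3) r(1)] by (simp add: r(2))
  also have "\<dots> = single (h \<otimes> g \<otimes> inv h) (act R h r)"
    using assms(2,3) by (intro sum_single) (auto simp: act_zero single_zero)
  finally show ?thesis by (simp add: homogeneous_def act_closed assms r)
qed

lemma zero_homogeneous: "0 \<in> homogeneous R g"
  using linear_on_zero[OF scale subspace coact_linear]
  by (simp add: homogeneous_def single_zero car_closed(1))

lemma supp_iff: "g \<in> supp G R \<longleftrightarrow> g \<in> carrier G \<and> (\<exists>r\<in>homogeneous R g. r \<noteq> 0)"
  using zero_homogeneous by (auto simp: supp_def)

lemma conj_supp:
  assumes "g \<in> supp G R" "h \<in> carrier G"
  shows "h \<otimes> g \<otimes> inv h \<in> supp G R"
proof -
  obtain r where r: "g \<in> carrier G" "r \<in> homogeneous R g" "r \<noteq> 0" using assms(1) by (auto simp: supp_iff)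
  then have rc: "r \<in> car R" by (simp add: homogeneous_def)
  \<comment> \<open>The action of h is invertible, so it cannot annihilate r.\<close>
  have "r = act R (inv h) (act R h r)"
    using assms(2) rc by (simp add: act_mult[symmetric] act_one)
  then have "act R h r \<noteq> 0" using r(3) act_zero assms(2) by fastforce
  with r assms(2) show ?thesis
    unfolding supp_iff by (intro conjI bexI[OF _ act_homogeneous]) auto
qed

text \<open>The coaction reads off the degree of a nonzero homogeneous element, and its coefficient
  at h extracts the term of degree h from a linear combination.\<close>

lemma homogeneous_independent:
  assumes b: "\<And>h. h \<in> D \<Longrightarrow> b h \<in> homogeneous R h" "\<And>h. h \<in> D \<Longrightarrow> b h \<noteq> 0" and D: "finite D"
  shows "inj_on b D" "\<not> module.dependent (scl R) (b ` D)"
proof -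
  interpret V: vector_space "scl R" by (rule scale)
  have bc: "b h \<in> car R" "coact R (b h) = single h (b h)" if "h \<in> D" for h
    using b(1)[OF that] by (auto simp: homogeneous_def)
  show inj: "inj_on b D"
  proof (rule inj_onI)
    fix g h assume gh: "g \<in> D" "h \<in> D" "b g = b h"
    then have "single g (b g) = single h (b g)" using bc by metis
    from fun_cong[OF this, of g] b(2)[OF gh(1)] show "g = h" by (auto simp: single_apply split: if_splits)
  qed
  show "\<not> V.dependent (b ` D)"
  proof (rule V.independent_if_scalars_zero)
    fix c x assume c: "(\<Sum>x\<in>b ` D. scl R (c x) x) = 0" and "x \<in> b ` D"
    then obtain h where h: "h \<in> D" "x = b h" by auto
    have "(\<Sum>g\<in>D. scl R (c (b g)) (b g)) = 0" using c by (simp add: sum.reindex[OF inj])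
    then have "0 = coact R (\<Sum>g\<in>D. scl R (c (b g)) (b g)) h" by (simp add: coact_zero)
    also have "\<dots> = (\<Sum>g\<in>D. coact R (scl R (c (b g)) (b g)) h)"
      by (rule linear_on_sum_image[OF scale subspace linear_on_coact[OF linear_on_id]])
        (auto intro: car_closed bc)
    also have "\<dots> = (\<Sum>g\<in>D. if g = h then scl R (c (b h)) (b h) else 0)"
      by (intro sum.cong refl) (auto simp: linear_onD[OF linear_on_coact[OF linear_on_id]] bc single_apply)
    also have "\<dots> = scl R (c (b h)) (b h)" using h D by simp
    finally show "c x = 0" using b(2)[OF h(1)] h(2) by simp
  qed (use D in simp)
qed

text \<open>An independent set with as many elements as the dimension spans. Nonemptiness of D makes
  the dimension positive and hence a basis of R finite.\<close>

lemma homogeneous_span: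
  assumes b: "\<And>h. h \<in> D \<Longrightarrow> b h \<in> homogeneous R h" "\<And>h. h \<in> D \<Longrightarrow> b h \<noteq> 0"
    and D: "finite D" "D \<noteq> {}" "card D = vector_space.dim (scl R) (car R)"
  shows "car R \<subseteq> module.span (scl R) (b ` D)"
proof -
  interpret V: vector_space "scl R" by (rule scale)
  note ind = homogeneous_independent[OF b D(1)]
  obtain B where B: "car R \<subseteq> V.span B" "card B = V.dim (car R)" using V.basis_exists by metis
  have "card B > 0" using B(2) D by (metis card_gt_0_iff)
  then have fB: "finite B" by (rule card_ge_0_finite)
  show ?thesis
  proof (rule ccontr)
    assume "\<not> ?thesis"
    then obtain v where v: "v \<in> car R" "v \<notin> V.span (b ` D)" by auto
    then have "V.independent (insert v (b ` D))" by (intro V.independent_insertI ind)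
    moreover have "insert v (b ` D) \<subseteq> V.span B"
      using v b(1) B(1) by (auto simp: homogeneous_def)
    ultimately have "card (insert v (b ` D)) \<le> card B"
      using V.independent_span_bound[OF fB] by blast
    moreover have "v \<notin> b ` D" using v V.span_base by blast
    ultimately show False using B(2) D(1,3) card_image[OF ind(1)] by simp
  qed
qed

text \<open>The coefficient of the coaction at g vanishes on every \<open>b h\<close> and therefore
  on r, where it is r itself.\<close>

lemma homogeneous_eq_zero:
  assumes b: "\<And>h. h \<in> D \<Longrightarrow> b h \<in> homogeneous R h" and span: "car R \<subseteq> module.span (scl R) (b ` D)"
    and r: "r \<in> homogeneous R g" "g \<notin> D"
  shows "r = 0"
proof -
  interpret V: vector_space "scl R" by (rule scale)
  have rc: "r \<in> car R" "coact R r = single g r" using r by (auto simp: homogeneous_def)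
  note lin = linear_on_coact[OF linear_on_id, of "car R" g]
  have "r \<in> V.span (b ` D)" using rc span by auto
  then have "r \<in> car R \<and> coact R r g = 0"
  proof (induction rule: V.span_induct_alt)
    case base
    then show ?case by (simp add: coact_zero car_closed)
  next
    case (step c x y)
    then have "x \<in> car R" "coact R x g = 0" using b r(2) by (auto simp: homogeneous_def single_apply)
    with step show ?case by (simp add: car_closed linear_onD[OF lin])
  qed
  then show ?thesis by (simp add: rc single_apply)
qed

text \<open>For a simple left ideal \<open>L\<close>, the left ideal \<open>n L \<subseteq> L\<close> is \<open>0\<close>, because \<open>n L = L\<close> gives \<open>L = n\<^sup>2 L = 0\<close>.\<close>

lemma semisimple_no_nilpotent_line:
  assumes ss: "semisimple_algebra R" and n: "n \<in> car R" "mul R n n = 0"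
    and line: "\<And>a. a \<in> car R \<Longrightarrow> \<exists>c. mul R a n = scl R c n"
  shows "n = 0"
proof -
  interpret V: vector_space "scl R" by (rule scale)
  note lin = bilinear_onD(2)[OF mul_bilinear n(1)]
  have ann: "mul R n x = 0" if L: "simple_left_ideal L R" and x: "x \<in> L" for L x
  proof -
    have Ls: "V.subspace L" "L \<subseteq> car R" "L \<noteq> {0}"
      and Lm: "\<And>a x. \<lbrakk>a \<in> car R; x \<in> L\<rbrakk> \<Longrightarrow> mul R a x \<in> L"
      and Lmin: "\<And>I. \<lbrakk>left_ideal I R; I \<subseteq> L\<rbrakk> \<Longrightarrow> I = {0} \<or> I = L"
      using L by (auto simp: simple_left_ideal_def left_ideal_def)
    let ?I = "mul R n ` L"
    have IL: "?I \<subseteq> L" using Lm n(1) by auto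
    have "left_ideal ?I R"
      unfolding left_ideal_def
    proof (intro conjI ballI)
      show "V.subspace ?I"
        unfolding V.subspace_def
      proof (intro conjI ballI allI)
        show "0 \<in> ?I" using mul_zero(1)[OF n(1)] V.subspace_0[OF Ls(1)] by force
        fix u v assume "u \<in> ?I" "v \<in> ?I"
        then obtain x y where xy: "x \<in> L" "y \<in> L" "u = mul R n x" "v = mul R n y" by auto
        then have "u + v = mul R n (x + y)" using Ls(2) by (simp add: linear_onD(1)[OF lin] subset_iff)
        then show "u + v \<in> ?I" using xy V.subspace_add[OF Ls(1)] by blast
      next
        fix c u assume "u \<in> ?I"
        then obtain x where x: "x \<in> L" "u = mul R n x" by auto
        then have "scl R c u = mul R n (scl R c x)" using Ls(2) by (simp add: linear_onD(2)[OF lin] subset_iff)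
        then show "scl R c u \<in> ?I" using x V.subspace_scale[OF Ls(1)] by blast
      qed
      show "?I \<subseteq> car R" using IL Ls(2) by auto
      fix a u assume a: "a \<in> car R" and "u \<in> ?I"
      then obtain x where x: "x \<in> L" "x \<in> car R" "u = mul R n x" using Ls(2) by auto
      obtain c where c: "mul R a n = scl R c n" using line[OF a] by auto
      \<comment> \<open>The hypothesis on the line moves a past n:
        \<open>a (n x) = (a n) x = c n x = n (c x)\<close>.\<close>
      have "mul R a u = mul R n (scl R c x)"
        using mul_assoc[OF a n(1) x(2)] by (simp add: x(3) c mul_scale n x(2))
      then show "mul R a u \<in> ?I" using x V.subspace_scale[OF Ls(1)] by blast
    qed
    from Lmin[OF this IL] show ?thesis
    proof
      assume "?I = L"
      have "x = 0" if x: "x \<in> L" for x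
      proof -
        obtain y where y: "y \<in> L" "x = mul R n y" using x \<open>?I = L\<close> by auto
        obtain z where z: "z \<in> L" "y = mul R n z" using y \<open>?I = L\<close> by auto
        have "x = mul R (mul R n n) z" using y z Ls(2) n(1) by (auto simp: mul_assoc subset_iff)
        then show "x = 0" using n(2) z Ls(2) by (auto simp: mul_zero)
      qed
      then have "L = {0}" using V.subspace_0[OF Ls(1)] by auto
      with Ls(3) show ?thesis by simp
    qed (use x in auto)
  qed
  \<comment> \<open>The unit is a sum of elements of simple left ideals, all of them killed by n;
    hence n = n 1 = 0.\<close>
  have "uni R \<in> V.span (\<Union> {L. simple_left_ideal L R})"
    using ss uni_closed by (simp add: semisimple_algebra_def)
  then have "uni R \<in> car R \<and> mul R n (uni R) = 0"
  proof (induction rule: V.span_induct_alt)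
    case base
    then show ?case by (simp add: car_closed mul_zero n)
  next
    case (step c x y)
    then have "x \<in> car R" "mul R n x = 0" using ann by (auto simp: simple_left_ideal_def left_ideal_def)
    with step show ?case by (simp add: car_closed linear_onD[OF lin])
  qed
  then show ?thesis by (simp add: uni_right n)
qed

text \<open>The relevant facts about the alternating group in abstract form: G/K has no element of
  order 2, and K acts freely by conjugation on its complement, as a Frobenius kernel does. Freeness
  gives |K| conjugates of g, which with the unit fill the dimension; the condition on squares keeps
  products of two conjugates out of the support.\<close>

lemma supp_subset_normal:
  assumes ss: "semisimple_algebra R" and K: "K \<lhd> G"
    and sq: "\<And>g. \<lbrakk>g \<in> carrier G; g \<notin> K\<rbrakk> \<Longrightarrow> g \<otimes> g \<notin> K"
    and cent: "\<And>g k. \<lbrakk>g \<in> carrier G; g \<notin> K; k \<in> K; k \<otimes> g = g \<otimes> k\<rbrakk> \<Longrightarrow> k = \<one>"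
    and dim: "vector_space.dim (scl R) (car R) = Suc (card K)"
  shows "supp G R \<subseteq> K"
proof
  fix g assume gs: "g \<in> supp G R"
  interpret V: vector_space "scl R" by (rule scale)
  interpret K: normal K G by (rule K)
  have g: "g \<in> carrier G" using gs by (simp add: supp_iff)
  have KG: "k \<in> carrier G" if "k \<in> K" for k using that by (rule K.mem_carrier)
  have fK: "finite K" using K.subset finite_group finite_subset by blast
  show "g \<in> K"
  proof (rule ccontr)
    assume gK: "g \<notin> K"
    let ?c = "\<lambda>k. k \<otimes> g \<otimes> inv k"
    define D where "D = insert \<one> (?c ` K)"
    \<comment> \<open>Equal conjugates of g under k and l mean that
      \<open>l\<^sup>-\<^sup>1 k\<close> commutes with g.\<close>
    have inj: "inj_on ?c K"
    proof (rule inj_onI)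
      fix k l assume k: "k \<in> K" and l: "l \<in> K" and eq: "?c k = ?c l"
      have kl: "inv l \<otimes> k \<in> K" using k l by simp
      note cl = KG[OF k] KG[OF l] g
      have "(inv l \<otimes> k) \<otimes> g = inv l \<otimes> (?c k \<otimes> k)" using cl by (simp add: m_assoc)
      also have "\<dots> = inv l \<otimes> (?c l \<otimes> k)" using eq by simp
      also have "\<dots> = (inv l \<otimes> l) \<otimes> g \<otimes> (inv l \<otimes> k)"
        using cl by (simp only: m_assoc m_closed inv_closed)
      also have "\<dots> = g \<otimes> (inv l \<otimes> k)" using cl by simp
      finally have "(inv l \<otimes> k) \<otimes> g = g \<otimes> (inv l \<otimes> k)" .
      from cent[OF g gK kl this] show "k = l" using KG[OF k] KG[OF l]
        by (metis inv_closed inv_equality inv_inv)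
    qed
    \<comment> \<open>Normality of K: \<open>k g k\<^sup>-\<^sup>1 = g (g\<^sup>-\<^sup>1 k g)
      k\<^sup>-\<^sup>1\<close>, and the bracket lies in K.\<close>
    have coset: "\<exists>\<kappa>\<in>K. ?c k = g \<otimes> \<kappa>" if k: "k \<in> K" for k
    proof
      have "inv g \<otimes> k \<otimes> g \<in> K" using K.inv_op_closed1[OF g k] .
      then show "inv g \<otimes> k \<otimes> g \<otimes> inv k \<in> K" using k by simp
      have "g \<otimes> (inv g \<otimes> k \<otimes> g \<otimes> inv k) = (g \<otimes> inv g) \<otimes> k \<otimes> g \<otimes> inv k"
        using KG[OF k] g by (simp only: m_assoc m_closed inv_closed)
      then show "?c k = g \<otimes> (inv g \<otimes> k \<otimes> g \<otimes> inv k)"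
        using KG[OF k] g by simp
    qed
    have notK: "g \<otimes> \<kappa> \<notin> K" if "\<kappa> \<in> K" for \<kappa>
    proof
      assume "g \<otimes> \<kappa> \<in> K"
      then have "g \<otimes> \<kappa> \<otimes> inv \<kappa> \<in> K" using that by simp
      then show False using gK g KG[OF that] by (simp add: m_assoc)
    qed
    have one: "\<one> \<notin> ?c ` K"
    proof
      assume "\<one> \<in> ?c ` K"
      then obtain k where k: "k \<in> K" "\<one> = ?c k" by (rule imageE) simp
      then obtain \<kappa> where "\<kappa> \<in> K" "?c k = g \<otimes> \<kappa>" using coset by blast
      with notK[of \<kappa>] k(2) K.one_closed show False by simp
    qed
    have cD: "card D = V.dim (car R)"
      using one fK by (simp add: D_def dim card_image[OF inj])
    have Ds: "D \<subseteq> supp G R"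
      using uni_homogeneous uni_nonzero conj_supp[OF gs KG] by (auto simp: D_def supp_iff)
    have "\<forall>h\<in>D. \<exists>r. r \<in> homogeneous R h \<and> r \<noteq> 0"
      using Ds supp_iff by blast
    then obtain b0 where b0: "\<forall>h\<in>D. b0 h \<in> homogeneous R h \<and> b0 h \<noteq> 0"
      by (rule bchoice[THEN exE])
    \<comment> \<open>Taking the unit itself in degree 1 makes multiplication by that basis vector a
      scaling.\<close>
    define b where "b = b0(\<one> := uni R)"
    have b: "b h \<in> homogeneous R h" "b h \<noteq> 0" if "h \<in> D" for h
      using that b0 uni_homogeneous uni_nonzero by (auto simp: b_def)
    have b1: "b \<one> = uni R" by (simp add: b_def)
    have span: "car R \<subseteq> V.span (b ` D)"
      by (rule homogeneous_span[OF b _ _ cD]) (use fK in \<open>auto simp: D_def\<close>)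
    have gD: "g \<in> D" unfolding D_def using g by (auto intro!: image_eqI[of _ _ \<one>])
    let ?n = "b g"
    have n: "?n \<in> car R" using b(1)[OF gD] by (simp add: homogeneous_def)
    \<comment> \<open>The degree h g lies in the coset of g g. If it were 1, then g g would lie in
      K; if it were a conjugate of g, then g would.\<close>
    have van: "mul R (b h) ?n = 0" if h: "h \<in> ?c ` K" for h
    proof (rule homogeneous_eq_zero[OF b(1) span])
      have hD: "h \<in> D" and hG: "h \<in> carrier G" using h KG g by (auto simp: D_def)
      show "mul R (b h) ?n \<in> homogeneous R (h \<otimes> g)" by (intro mul_homogeneous b hD gD hG g)
      obtain \<kappa> where \<kappa>: "\<kappa> \<in> K" "h = g \<otimes> \<kappa>" using h coset by auto
      note \<kappa>G = KG[OF \<kappa>(1)]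
      show "h \<otimes> g \<notin> D"
      proof
        assume "h \<otimes> g \<in> D"
        then have "h \<otimes> g = \<one> \<or> h \<otimes> g \<in> ?c ` K" by (simp add: D_def)
        then show False
        proof
          assume 1: "h \<otimes> g = \<one>"
          \<comment> \<open>This element of K carries h g to g g, because h = g \<kappa>.\<close>
          have "inv g \<otimes> inv \<kappa> \<otimes> g \<in> K" using K.inv_op_closed1[OF g] \<kappa>(1) by simp
          moreover have "h \<otimes> g \<otimes> (inv g \<otimes> inv \<kappa> \<otimes> g) = g \<otimes> g"
          proof -
            have "h \<otimes> g \<otimes> (inv g \<otimes> inv \<kappa> \<otimes> g) = g \<otimes> (\<kappa> \<otimes> (g \<otimes> inv g) \<otimes> inv \<kappa>) \<otimes> g"
              using g \<kappa>G unfolding \<kappa>(2) by (simp only: m_assoc m_closed inv_closed)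
            then show ?thesis using g \<kappa>G by simp
          qed
          ultimately have "g \<otimes> g \<in> K" using 1 g \<kappa>G by simp
          with sq[OF g gK] show False by simp
        next
          assume "h \<otimes> g \<in> ?c ` K"
          then obtain k where k: "h \<otimes> g = ?c k" "k \<in> K" by (rule imageE)
          obtain \<mu> where 2: "\<mu> \<in> K" "h \<otimes> g = g \<otimes> \<mu>" using coset[OF k(2)] k(1) by auto
          then have "\<kappa> \<otimes> g = \<mu>" using g \<kappa>G KG by (simp add: \<kappa>(2) m_assoc)
          then have "inv \<kappa> \<otimes> (\<kappa> \<otimes> g) \<in> K" using 2(1) \<kappa>(1) by simp
          with gK show False using g \<kappa>G by (simp add: m_assoc[symmetric])
        qed
      qed
    qed auto
    \<comment> \<open>The unit fixes n and every other basis vector kills it, so R n stays on the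
      line of n.\<close>
    have "\<exists>c. mul R a ?n = scl R c ?n" if "a \<in> car R" for a
    proof -
      have "a \<in> V.span (b ` D)" using that span by auto
      then have "a \<in> car R \<and> (\<exists>c. mul R a ?n = scl R c ?n)"
      proof (induction rule: V.span_induct_alt)
        case base
        then show ?case by (auto intro!: exI[of _ 0] simp: car_closed mul_zero n)
      next
        case (step c x y)
        have x: "x \<in> car R" using step(1) b(1) by (auto simp: homogeneous_def)
        have "\<exists>d. mul R x ?n = scl R d ?n"
        proof (cases "x = uni R")
          case True
          then show ?thesis using n by (auto intro!: exI[of _ 1] simp: uni_left)
        next
          case False
          then show ?thesis using step(1) van b1 by (auto intro!: exI[of _ 0] simp: D_def)
        qed
        then obtain d e where de: "mul R x ?n = scl R d ?n" "mul R y ?n = scl R e ?n" using step by auto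
        have "mul R (scl R c x + y) ?n = scl R (c * d + e) ?n"
          using x step n linear_onD(1)[OF bilinear_onD(1)[OF mul_bilinear n], of "scl R c x" y]
          by (simp add: car_closed mul_scale de V.scale_left_distrib)
        with x step show ?case by (auto intro!: car_closed)
      qed
      then show ?thesis by simp
    qed
    moreover have "mul R ?n ?n = 0"
      using g by (intro van image_eqI[of _ _ \<one>]) auto
    ultimately have "?n = 0" by (intro semisimple_no_nilpotent_line[OF ss n])
    with b(2)[OF gD] show False by simp
  qed
qed

end

section \<open>The alternating group on four letters\<close>

text \<open>Tables of values at the four letters let the claims on squares and centralizers be
  checked case by case.\<close>

lemma klein_values:
  assumes "p \<in> klein"
  shows "(p 1, p 2, p 3, p 4) \<in> {(1, 2, 3, 4), (2, 1, 4, 3), (3, 4, 1, 2), (4, 3, 2, 1)}"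
  using assms unfolding klein_def
  by (elim insertE emptyE; hypsubst) (simp_all add: transpose_def)

text \<open>\<open>t\<close> is the 3-cycle sending 1 to 2, 2 to 3 and 3 to 1. The cosets of
  \<open>klein\<close> by id, \<open>t\<close> and its square exhaust the group by counting: twelve
  permutations, told apart by their values at 1 and 2, in a group of order 12.\<close>

lemma alt_group_4_cases:
  assumes "g \<in> carrier (alt_group 4)" "g \<notin> klein"
  defines "t \<equiv> transpose 1 2 \<circ> transpose 2 3"
  shows "g \<in> (\<lambda>k. t \<circ> k) ` klein \<union> (\<lambda>k. t \<circ> t \<circ> k) ` klein"
proof -
  define a b c :: "nat \<Rightarrow> nat" where "a = transpose 1 2 \<circ> transpose 3 4"
    and "b = transpose 1 3 \<circ> transpose 2 4" and "c = transpose 1 4 \<circ> transpose 2 3"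
  note abc = a_def b_def c_def
  have K: "klein = {id, a, b, c}" by (simp add: klein_def abc)
  define E where "E = [id, a, b, c, t, t \<circ> a, t \<circ> b, t \<circ> c, t \<circ> t, t \<circ> t \<circ> a, t \<circ> t \<circ> b, t \<circ> t \<circ> c]"
  have sE: "set E = klein \<union> (\<lambda>k. t \<circ> k) ` klein \<union> (\<lambda>k. t \<circ> t \<circ> k) ` klein"
    by (auto simp: E_def K)
  interpret A: group "alt_group 4" by (rule alt_group_is_group)
  have tc: "t \<in> carrier (alt_group 4)"
    unfolding t_def alt_group_carrier
    by (auto intro!: permutes_compose permutes_swap_id simp: evenperm_comp permutation_swap_id evenperm_swap)
  have kc: "k \<in> carrier (alt_group 4)" if "k \<in> klein" for k
    using subgroup.mem_carrier[OF subgroup_klein that] .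
  have "set E \<subseteq> carrier (alt_group 4)"
    using A.m_closed tc kc unfolding sE alt_group_mult by auto
  moreover have "distinct (map (\<lambda>p. (p 1, p 2)) E)"
    by (simp add: E_def abc t_def transpose_def)
  then have "card (set E) = length E" by (simp add: distinct_card distinct_map)
  moreover have "card (carrier (alt_group 4)) = 12"
    using alt_group_card_carrier[of 4] by (simp add: fact_numeral)
  moreover have "finite (carrier (alt_group 4))"
    using \<open>card (carrier (alt_group 4)) = 12\<close> by (intro card_ge_0_finite) simp
  ultimately have "carrier (alt_group 4) = set E"
    by (intro card_subset_eq[symmetric]) (auto simp: E_def)
  with assms sE show ?thesis by auto
qed

text \<open>Elements outside \<open>klein\<close> are 3-cycles. The square of a 3-cycle is again a
  3-cycle, and a permutation commuting with it fixes its unique fixed letter, whereas nontrivial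
  elements of \<open>klein\<close> move every letter. The proof verifies this on tables of
  values.\<close>

lemma
  assumes g: "g \<in> carrier (alt_group 4)" "g \<notin> klein"
  shows square_notin_klein: "g \<circ> g \<notin> klein"
    and klein_centralizer: "\<lbrakk>k \<in> klein; k \<circ> g = g \<circ> k\<rbrakk> \<Longrightarrow> k = id"
proof -
  \<comment> \<open>The eight 3-cycles, in pairs of mutual inverses with a common fixed
    letter.\<close>
  have g_values: "(g 1, g 2, g 3, g 4) \<in> {(2, 3, 1, 4), (3, 1, 2, 4), (3, 2, 4, 1), (4, 2, 1, 3),
    (1, 3, 4, 2), (1, 4, 2, 3), (2, 4, 3, 1), (4, 1, 3, 2)}"
    using alt_group_4_cases[OF g] unfolding klein_def image_insert image_empty
    by (elim UnE insertE emptyE; hypsubst) (simp_all add: transpose_def)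
  show "g \<circ> g \<notin> klein"
    using g_values by (intro notI, drule_tac klein_values) auto
  show "k = id" if k: "k \<in> klein" "k \<circ> g = g \<circ> k"
  proof -
    have "k (g i) = g (k i)" for i using fun_cong[OF k(2), of i] by simp
    \<comment> \<open>The letter 1 is enough to recognise the identity, since all other elements of
      \<open>klein\<close> move it.\<close>
    from this[of 1] this[of 2] this[of 3] this[of 4] have "k 1 = 1"
      using g_values klein_values[OF k(1)] by auto
    with k(1) show ?thesis
      unfolding klein_def by (elim insertE emptyE) (simp_all add: transpose_def)
  qed
qed

text \<open>\<open>klein\<close> consists of the elements of square 1:
  \<open>square_notin_klein\<close> shows that no other element has this property, and the property
  is stable under conjugation.\<close>

lemma klein_normal: "klein \<lhd> alt_group 4"
proof -
  interpret A: group "alt_group 4" by (rule alt_group_is_group)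
  let ?G = "alt_group 4"
  have K: "p \<in> klein" if "p \<in> carrier ?G" "p \<circ> p = id" for p
    using that square_notin_klein[of p] by (auto simp: klein_def)
  have sq: "k \<otimes>\<^bsub>?G\<^esub> k = \<one>\<^bsub>?G\<^esub>" if "k \<in> klein" for k
    using that klein_mult(1-3) by (auto simp: klein_def alt_group_mult alt_group_one)
  show ?thesis
  proof (rule A.normal_invI[OF subgroup_klein])
    fix x h assume x: "x \<in> carrier ?G" and h: "h \<in> klein"
    have hc: "h \<in> carrier ?G" using subgroup.mem_carrier[OF subgroup_klein h] .
    let ?y = "x \<otimes>\<^bsub>?G\<^esub> h \<otimes>\<^bsub>?G\<^esub> inv\<^bsub>?G\<^esub> x"
    have "?y \<otimes>\<^bsub>?G\<^esub> ?y = x \<otimes>\<^bsub>?G\<^esub> (h \<otimes>\<^bsub>?G\<^esub> (inv\<^bsub>?G\<^esub> x \<otimes>\<^bsub>?G\<^esub> x) \<otimes>\<^bsub>?G\<^esub> h) \<otimes>\<^bsub>?G\<^esub> inv\<^bsub>?G\<^esub> x"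
      using x hc by (simp only: A.m_assoc A.m_closed A.inv_closed)
    also have "\<dots> = \<one>\<^bsub>?G\<^esub>" using x hc sq[OF h] by simp
    finally have "?y \<circ> ?y = id" by (simp only: alt_group_mult alt_group_one)
    moreover have "?y \<in> carrier ?G" using x hc by (intro A.m_closed A.inv_closed)
    ultimately show "?y \<in> klein" by (intro K)
  qed
qed

lemma card_klein: "card klein = 4"
  using klein_mult(10-15) by (auto simp: klein_def)

theorem proposition3p6:
  fixes R :: "('k::{alg_closed_field, field_char_0}, 'r::ab_group_add, nat \<Rightarrow> nat) braided_data"
  assumes "braided_hopf_algebra (alt_group 4) R"
    and "semisimple_algebra R"
    and "vector_space.dim (scl R) (car R) = 5"
  shows "supp (alt_group 4) R \<subseteq> klein
    \<and> normal_hopf_subalgebra (biproduct_sub klein R) (biproduct (alt_group 4) R)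
    \<and> vector_space.dim (scl (biproduct (alt_group 4) R)) (biproduct_sub klein R) = 20"
proof -
  interpret braided_hopf_algebra "alt_group 4" R by fact
  have supp: "supp (alt_group 4) R \<subseteq> klein"
    using square_notin_klein klein_centralizer
    by (intro supp_subset_normal[OF assms(2) klein_normal])
      (auto simp: alt_group_mult alt_group_one card_klein assms(3))
  \<comment> \<open>This is 4 * 5; finiteness of \<open>klein\<close> comes from its explicit
    enumeration.\<close>
  moreover have "vector_space.dim (fun_scale (scl R)) (fun_space klein (car R)) = 20"
    using dim_fun_space[OF scale subspace, of klein] assms(3) by (simp add: card_klein klein_def[THEN arg_cong[of _ _ finite]])
  ultimately show ?thesis
    using normal_hopf_subalgebra_biproduct_sub[OF klein_normal]
    by (simp add: scl_biprod biproduct_sub_def)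
qed

end
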